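(* Let $\mathbb{X}$ and $\mathbb{A}$ be two monoidal categories and let $F\colon\mathbb{X}\to\mathbb{A}$ be a lax monoidal functor between them, with structure natural transformations $\psi_0\colon J\to FI$ and $\psi_2\colon FX\otimes FY\to F(X\otimes Y)$, where $J$ is the unit of $\mathbb{A}$ and $I$ the unit of $\mathbb{X}$. The following profunctors, $\mathbb{A}\rtimes_F\mathbb{X}\colon\mathbb{A}\times\mathbb{X}\to\mathbb{A}\times\mathbb{X}$ and $\mathbb{X}\ltimes_F\mathbb{A}\colon\mathbb{X}\times\mathbb{A}\to\mathbb{X}\times\mathbb{A}$, determine two promonads, and therefore two Kleisli categories: $$\mathbb{A}\rtimes_F\mathbb{X}\,(A,X;B,Y)=\int^{M\in\mathbb{X}}\mathbb{A}(A;B\otimes FM)\times\mathbb{X}(M\otimes X;Y),$$ $$\mathbb{X}\ltimes_F\mathbb{A}\,(X,A;Y,B)=\int^{M\in\mathbb{X}}\mathbb{A}(A;FM\otimes B)\times\mathbb{X}(X\otimes M;Y).$$ These two Kleisli categories are $(\mathbb{A},\mathbb{X})$-bimodular and $(\mathbb{X},\mathbb{A})$-bimodular, respectively.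
   Context: Monoidal categories and monoidal actions are taken to be strict. A profunctor $P\colon\mathbb{C}\to\mathbb{C}$ is a functor $\mathbb{C}^{op}\times\mathbb{C}\to\mathbf{Set}$. A promonad on $\mathbb{C}$ is a monoid in the category of endoprofunctors on $\mathbb{C}$ under coend composition; its Kleisli category has the objects of $\mathbb{C}$ and the elements of $P(C;D)$ as morphisms $C\to D$. Here the promonad units are given by $M=I$ and $\psi_0$, and the multiplications by composing morphisms and using $\psi_2$. An $(\mathbb{M},\mathbb{N})$-bimodular category is a category $\mathbb{C}$ with a left monoidal action $(\triangleright)\colon\mathbb{M}\times\mathbb{C}\to\mathbb{C}$ and a right monoidal action $(\triangleleft)\colon\mathbb{C}\times\mathbb{N}\to\mathbb{C}$ that are compatible: $M\triangleright(X\triangleleft N)=(M\triangleright X)\triangleleft N$. The actions on the Kleisli categories are those given on objects by tensoring on the outer sides: $A'\triangleright(A,X)=(A'\otimes A,X)$ and $(A,X)\triangleleft X'=(A,X\otimes X')$ for the first; $X'\triangleright(X,A)=(X'\otimes X,A)$ and $(X,A)\triangleleft A'=(X,A\otimes A')$ for the second. *)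

theory Defs
  imports Main "HOL-Library.FuncSet"
begin

section \<open>Categories, functors, natural transformations\<close>

text \<open>
  Hom-sets of distinct pairs of objects may overlap, so composition and the arrow part of a
  functor take the objects involved as arguments: \<open>Cmp C a b c g f\<close> is the composite of
  \<open>f : a \<rightarrow> b\<close> followed by \<open>g : b \<rightarrow> c\<close>.
\<close>

record ('o, 'm) cat =
  Ob :: "'o set"
  Hom :: "'o \<Rightarrow> 'o \<Rightarrow> 'm set"
  Idn :: "'o \<Rightarrow> 'm"
  Cmp :: "'o \<Rightarrow> 'o \<Rightarrow> 'o \<Rightarrow> 'm \<Rightarrow> 'm \<Rightarrow> 'm"

locale category =
  fixes C :: "('o, 'm, 'z) cat_scheme"
  assumes idn_in: "a \<in> Ob C \<Longrightarrow> Idn C a \<in> Hom C a a"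
    and cmp_in: "\<lbrakk>a \<in> Ob C; b \<in> Ob C; c \<in> Ob C; f \<in> Hom C a b; g \<in> Hom C b c\<rbrakk>
      \<Longrightarrow> Cmp C a b c g f \<in> Hom C a c"
    and cmp_idn_right: "\<lbrakk>a \<in> Ob C; b \<in> Ob C; f \<in> Hom C a b\<rbrakk> \<Longrightarrow> Cmp C a a b f (Idn C a) = f"
    and cmp_idn_left: "\<lbrakk>a \<in> Ob C; b \<in> Ob C; f \<in> Hom C a b\<rbrakk> \<Longrightarrow> Cmp C a b b (Idn C b) f = f"
    and cmp_assoc: "\<lbrakk>a \<in> Ob C; b \<in> Ob C; c \<in> Ob C; d \<in> Ob C;
        f \<in> Hom C a b; g \<in> Hom C b c; h \<in> Hom C c d\<rbrakk>
      \<Longrightarrow> Cmp C a c d h (Cmp C a b c g f) = Cmp C a b d (Cmp C b c d h g) f"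

definition op_cat :: "('o, 'm, 'z) cat_scheme \<Rightarrow> ('o, 'm) cat" where
  "op_cat C = \<lparr>Ob = Ob C, Hom = (\<lambda>a b. Hom C b a), Idn = Idn C,
     Cmp = (\<lambda>a b c g f. Cmp C c b a f g)\<rparr>"

definition prod_cat ::
  "('o1, 'm1, 'z1) cat_scheme \<Rightarrow> ('o2, 'm2, 'z2) cat_scheme \<Rightarrow> ('o1 \<times> 'o2, 'm1 \<times> 'm2) cat" where
  "prod_cat C D = \<lparr>Ob = Ob C \<times> Ob D,
     Hom = (\<lambda>p q. Hom C (fst p) (fst q) \<times> Hom D (snd p) (snd q)),
     Idn = (\<lambda>p. (Idn C (fst p), Idn D (snd p))),
     Cmp = (\<lambda>p q r g f. (Cmp C (fst p) (fst q) (fst r) (fst g) (fst f),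
                          Cmp D (snd p) (snd q) (snd r) (snd g) (snd f)))\<rparr>"

text \<open>The category of sets with elements in the type \<open>'p\<close>; its arrows are extensional functions.\<close>

definition set_cat :: "('p set, 'p \<Rightarrow> 'p) cat" where
  "set_cat = \<lparr>Ob = UNIV, Hom = (\<lambda>S T. S \<rightarrow>\<^sub>E T), Idn = (\<lambda>S. \<lambda>x\<in>S. x),
     Cmp = (\<lambda>S T U g f. compose S g f)\<rparr>"

record ('o1, 'm1, 'o2, 'm2) func =
  Fo :: "'o1 \<Rightarrow> 'o2"
  Fm :: "'o1 \<Rightarrow> 'o1 \<Rightarrow> 'm1 \<Rightarrow> 'm2"

locale is_functor = dom: category C + cod: category D
  for C :: "('o1, 'm1, 'z1) cat_scheme" and D :: "('o2, 'm2, 'z2) cat_scheme" +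
  fixes F :: "('o1, 'm1, 'o2, 'm2) func"
  assumes Fo_in: "a \<in> Ob C \<Longrightarrow> Fo F a \<in> Ob D"
    and Fm_in: "\<lbrakk>a \<in> Ob C; b \<in> Ob C; f \<in> Hom C a b\<rbrakk> \<Longrightarrow> Fm F a b f \<in> Hom D (Fo F a) (Fo F b)"
    and Fm_idn: "a \<in> Ob C \<Longrightarrow> Fm F a a (Idn C a) = Idn D (Fo F a)"
    and Fm_cmp: "\<lbrakk>a \<in> Ob C; b \<in> Ob C; c \<in> Ob C; f \<in> Hom C a b; g \<in> Hom C b c\<rbrakk>
      \<Longrightarrow> Fm F a c (Cmp C a b c g f)
        = Cmp D (Fo F a) (Fo F b) (Fo F c) (Fm F b c g) (Fm F a b f)"

definition func_comp ::
  "('o2, 'm2, 'o3, 'm3) func \<Rightarrow> ('o1, 'm1, 'o2, 'm2) func \<Rightarrow> ('o1, 'm1, 'o3, 'm3) func" where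
  "func_comp G F = \<lparr>Fo = (\<lambda>a. Fo G (Fo F a)),
     Fm = (\<lambda>a b f. Fm G (Fo F a) (Fo F b) (Fm F a b f))\<rparr>"

definition func_prod ::
  "('o1, 'm1, 'o2, 'm2) func \<Rightarrow> ('o3, 'm3, 'o4, 'm4) func
    \<Rightarrow> ('o1 \<times> 'o3, 'm1 \<times> 'm3, 'o2 \<times> 'o4, 'm2 \<times> 'm4) func" where
  "func_prod F G = \<lparr>Fo = (\<lambda>p. (Fo F (fst p), Fo G (snd p))),
     Fm = (\<lambda>p q f. (Fm F (fst p) (fst q) (fst f), Fm G (snd p) (snd q) (snd f)))\<rparr>"

locale nat_trans = src: is_functor C D F + tgt: is_functor C D G
  for C :: "('o1, 'm1, 'z1) cat_scheme" and D :: "('o2, 'm2, 'z2) cat_scheme"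
    and F G :: "('o1, 'm1, 'o2, 'm2) func" +
  fixes \<tau> :: "'o1 \<Rightarrow> 'm2"
  assumes component_in: "a \<in> Ob C \<Longrightarrow> \<tau> a \<in> Hom D (Fo F a) (Fo G a)"
    and natural: "\<lbrakk>a \<in> Ob C; b \<in> Ob C; f \<in> Hom C a b\<rbrakk>
      \<Longrightarrow> Cmp D (Fo F a) (Fo F b) (Fo G b) (\<tau> b) (Fm F a b f)
        = Cmp D (Fo F a) (Fo G a) (Fo G b) (Fm G a b f) (\<tau> a)"

section \<open>Strict monoidal categories and lax monoidal functors\<close>

record ('o, 'm) moncat = "('o, 'm) cat" +
  Tensor :: "('o \<times> 'o, 'm \<times> 'm, 'o, 'm) func"
  Unt :: 'o

abbreviation ten_ob :: "('o, 'm, 'z) moncat_scheme \<Rightarrow> 'o \<Rightarrow> 'o \<Rightarrow> 'o" where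
  "ten_ob M a b \<equiv> Fo (Tensor M) (a, b)"

text \<open>\<open>ten_ar M a a' b b' f g\<close> is the tensor of \<open>f : a \<rightarrow> a'\<close> and \<open>g : b \<rightarrow> b'\<close>.\<close>

abbreviation ten_ar ::
  "('o, 'm, 'z) moncat_scheme \<Rightarrow> 'o \<Rightarrow> 'o \<Rightarrow> 'o \<Rightarrow> 'o \<Rightarrow> 'm \<Rightarrow> 'm \<Rightarrow> 'm" where
  "ten_ar M a a' b b' f g \<equiv> Fm (Tensor M) (a, b) (a', b') (f, g)"

locale strict_monoidal = category M + tensor: is_functor "prod_cat M M" M "Tensor M"
  for M :: "('o, 'm, 'z) moncat_scheme" +
  assumes unt_in: "Unt M \<in> Ob M"
    and ten_ob_assoc: "\<lbrakk>a \<in> Ob M; b \<in> Ob M; c \<in> Ob M\<rbrakk>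
      \<Longrightarrow> ten_ob M (ten_ob M a b) c = ten_ob M a (ten_ob M b c)"
    and ten_ob_unt_left: "a \<in> Ob M \<Longrightarrow> ten_ob M (Unt M) a = a"
    and ten_ob_unt_right: "a \<in> Ob M \<Longrightarrow> ten_ob M a (Unt M) = a"
    and ten_ar_assoc: "\<lbrakk>a \<in> Ob M; a' \<in> Ob M; b \<in> Ob M; b' \<in> Ob M; c \<in> Ob M; c' \<in> Ob M;
        f \<in> Hom M a a'; g \<in> Hom M b b'; h \<in> Hom M c c'\<rbrakk>
      \<Longrightarrow> ten_ar M (ten_ob M a b) (ten_ob M a' b') c c' (ten_ar M a a' b b' f g) h
        = ten_ar M a a' (ten_ob M b c) (ten_ob M b' c') f (ten_ar M b b' c c' g h)"
    and ten_ar_unt_left: "\<lbrakk>a \<in> Ob M; a' \<in> Ob M; f \<in> Hom M a a'\<rbrakk>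
      \<Longrightarrow> ten_ar M (Unt M) (Unt M) a a' (Idn M (Unt M)) f = f"
    and ten_ar_unt_right: "\<lbrakk>a \<in> Ob M; a' \<in> Ob M; f \<in> Hom M a a'\<rbrakk>
      \<Longrightarrow> ten_ar M a a' (Unt M) (Unt M) f (Idn M (Unt M)) = f"

locale lax_monoidal_functor =
  X: strict_monoidal X + A: strict_monoidal A + is_functor X A F +
  mult: nat_trans "prod_cat X X" A
    "func_comp (Tensor A) (func_prod F F)" "func_comp F (Tensor X)" \<psi>2
  for X :: "('xo, 'xm, 'z1) moncat_scheme" and A :: "('ao, 'am, 'z2) moncat_scheme"
    and F :: "('xo, 'xm, 'ao, 'am) func"
    and \<psi>0 :: 'am and \<psi>2 :: "'xo \<times> 'xo \<Rightarrow> 'am" +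
  assumes psi0_in: "\<psi>0 \<in> Hom A (Unt A) (Fo F (Unt X))"
    and psi2_assoc: "\<lbrakk>x \<in> Ob X; y \<in> Ob X; z \<in> Ob X\<rbrakk> \<Longrightarrow>
      Cmp A (ten_ob A (ten_ob A (Fo F x) (Fo F y)) (Fo F z))
          (ten_ob A (Fo F (ten_ob X x y)) (Fo F z))
          (Fo F (ten_ob X (ten_ob X x y) z))
        (\<psi>2 (ten_ob X x y, z))
        (ten_ar A (ten_ob A (Fo F x) (Fo F y)) (Fo F (ten_ob X x y)) (Fo F z) (Fo F z)
          (\<psi>2 (x, y)) (Idn A (Fo F z)))
      = Cmp A (ten_ob A (Fo F x) (ten_ob A (Fo F y) (Fo F z)))
          (ten_ob A (Fo F x) (Fo F (ten_ob X y z)))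
          (Fo F (ten_ob X x (ten_ob X y z)))
        (\<psi>2 (x, ten_ob X y z))
        (ten_ar A (Fo F x) (Fo F x) (ten_ob A (Fo F y) (Fo F z)) (Fo F (ten_ob X y z))
          (Idn A (Fo F x)) (\<psi>2 (y, z)))"
    and psi_unit_left: "x \<in> Ob X \<Longrightarrow>
      Cmp A (ten_ob A (Unt A) (Fo F x)) (ten_ob A (Fo F (Unt X)) (Fo F x)) (Fo F x)
        (\<psi>2 (Unt X, x))
        (ten_ar A (Unt A) (Fo F (Unt X)) (Fo F x) (Fo F x) \<psi>0 (Idn A (Fo F x)))
      = Idn A (Fo F x)"
    and psi_unit_right: "x \<in> Ob X \<Longrightarrow>
      Cmp A (ten_ob A (Fo F x) (Unt A)) (ten_ob A (Fo F x) (Fo F (Unt X))) (Fo F x)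
        (\<psi>2 (x, Unt X))
        (ten_ar A (Fo F x) (Fo F x) (Unt A) (Fo F (Unt X)) (Idn A (Fo F x)) \<psi>0)
      = Idn A (Fo F x)"

section \<open>Coends of sets\<close>

type_synonym ('o, 'm, 'p) endoprof = "('o \<times> 'o, 'm \<times> 'm, 'p set, 'p \<Rightarrow> 'p) func"

text \<open>A profunctor \<open>P : C \<rightarrow> C\<close> is contravariant in its first argument.\<close>

abbreviation endoprofunctor :: "('o, 'm, 'z) cat_scheme \<Rightarrow> ('o, 'm, 'p) endoprof \<Rightarrow> bool" where
  "endoprofunctor C P \<equiv> is_functor (prod_cat (op_cat C) C) set_cat P"

text \<open>
  The coend of \<open>H\<close> as a coequaliser in sets: the disjoint union of the \<open>H(m, m)\<close> modulo the
  equivalence relation generated by \<open>H(u, 1) t \<sim> H(1, u) t\<close> for \<open>u : m \<rightarrow> n\<close> and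
  \<open>t \<in> H(n, m)\<close>.
\<close>

definition coend_carrier :: "('o, 'm, 'z) cat_scheme \<Rightarrow> ('o, 'm, 'p) endoprof \<Rightarrow> ('o \<times> 'p) set" where
  "coend_carrier C H = (SIGMA m : Ob C. Fo H (m, m))"

definition coend_rel ::
  "('o, 'm, 'z) cat_scheme \<Rightarrow> ('o, 'm, 'p) endoprof \<Rightarrow> (('o \<times> 'p) \<times> ('o \<times> 'p)) set" where
  "coend_rel C H =
     {((m, Fm H (n, m) (m, m) (u, Idn C m) t), (n, Fm H (n, m) (n, n) (Idn C n, u) t)) | m n u t.
        m \<in> Ob C \<and> n \<in> Ob C \<and> u \<in> Hom C m n \<and> t \<in> Fo H (n, m)}"

definition coend_eq ::
  "('o, 'm, 'z) cat_scheme \<Rightarrow> ('o, 'm, 'p) endoprof \<Rightarrow> (('o \<times> 'p) \<times> ('o \<times> 'p)) set" where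
  "coend_eq C H = (coend_rel C H \<union> (coend_rel C H)\<inverse>)\<^sup>*
     \<inter> (coend_carrier C H \<times> coend_carrier C H)"

definition coend :: "('o, 'm, 'z) cat_scheme \<Rightarrow> ('o, 'm, 'p) endoprof \<Rightarrow> ('o \<times> 'p) set set" where
  "coend C H = coend_carrier C H // coend_eq C H"

definition coend_inj ::
  "('o, 'm, 'z) cat_scheme \<Rightarrow> ('o, 'm, 'p) endoprof \<Rightarrow> 'o \<Rightarrow> 'p \<Rightarrow> ('o \<times> 'p) set" where
  "coend_inj C H m t = coend_eq C H `` {(m, t)}"

text \<open>
  The value at a class \<open>T\<close> of the function induced by \<open>\<phi>\<close> on representatives; it is meaningful
  only when \<open>\<phi>\<close> is constant on \<open>T\<close>.
\<close>

definition coend_case :: "('o \<Rightarrow> 'p \<Rightarrow> 'q) \<Rightarrow> ('o \<times> 'p) set \<Rightarrow> 'q" where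
  "coend_case \<phi> T = the_elem ((\<lambda>(m, t). \<phi> m t) ` T)"

definition coend_map ::
  "('o, 'm, 'z) cat_scheme \<Rightarrow> ('o, 'm, 'p) endoprof \<Rightarrow> ('o, 'm, 'q) endoprof
    \<Rightarrow> ('o \<Rightarrow> 'p \<Rightarrow> 'q) \<Rightarrow> ('o \<times> 'p) set \<Rightarrow> ('o \<times> 'q) set" where
  "coend_map C H K \<theta> = (\<lambda>T\<in>coend C H. coend_case (\<lambda>m t. coend_inj C K m (\<theta> m t)) T)"

section \<open>Composition of profunctors and promonads\<close>

definition hom_prof :: "('o, 'm, 'z) cat_scheme \<Rightarrow> ('o, 'm, 'm) endoprof" where
  "hom_prof C = \<lparr>Fo = (\<lambda>(c, d). Hom C c d),
     Fm = (\<lambda>(c, d) (c', d') (f, g).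
       \<lambda>h\<in>Hom C c d. Cmp C c' d d' g (Cmp C c' c d h f))\<rparr>"

text \<open>
  The composite of \<open>P\<close> and \<open>Q\<close> at \<open>(c; e)\<close> is the coend over \<open>d\<close> of
  \<open>P(c; d) \<times> Q(d; e)\<close>.
\<close>

definition prof_comp_integrand ::
  "('o, 'm, 'z) cat_scheme \<Rightarrow> ('o, 'm, 'p) endoprof \<Rightarrow> ('o, 'm, 'q) endoprof \<Rightarrow> 'o \<Rightarrow> 'o
    \<Rightarrow> ('o, 'm, 'p \<times> 'q) endoprof" where
  "prof_comp_integrand C P Q c e = \<lparr>Fo = (\<lambda>(d', d). Fo P (c, d) \<times> Fo Q (d', e)),
     Fm = (\<lambda>(d1', d1) (d2', d2) (u, v).
       \<lambda>(p, q) \<in> Fo P (c, d1) \<times> Fo Q (d1', e).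
         (Fm P (c, d1) (c, d2) (Idn C c, v) p, Fm Q (d1', e) (d2', e) (u, Idn C e) q))\<rparr>"

definition prof_comp ::
  "('o, 'm, 'z) cat_scheme \<Rightarrow> ('o, 'm, 'p) endoprof \<Rightarrow> ('o, 'm, 'q) endoprof
    \<Rightarrow> ('o, 'm, ('o \<times> 'p \<times> 'q) set) endoprof" where
  "prof_comp C P Q = \<lparr>Fo = (\<lambda>(c, e). coend C (prof_comp_integrand C P Q c e)),
     Fm = (\<lambda>(c, e) (c', e') (f, g).
       coend_map C (prof_comp_integrand C P Q c e) (prof_comp_integrand C P Q c' e')
         (\<lambda>d (p, q). (Fm P (c, d) (c', d) (f, Idn C d) p, Fm Q (d, e) (d, e') (Idn C d, g) q)))\<rparr>"

text \<open>
  Natural transformations of endoprofunctors. The element types of \<open>P\<close> and \<open>Q\<close> may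
  differ, so this is not literally an instance of \<open>nat_trans\<close> into one \<open>set_cat\<close>.
\<close>

locale prof_trans = src: is_functor "prod_cat (op_cat C) C" set_cat P
  + tgt: is_functor "prod_cat (op_cat C) C" set_cat Q + category C
  for C :: "('o, 'm, 'z) cat_scheme" and P :: "('o, 'm, 'p) endoprof"
    and Q :: "('o, 'm, 'q) endoprof" +
  fixes \<tau> :: "'o \<times> 'o \<Rightarrow> 'p \<Rightarrow> 'q"
  assumes component_in: "\<lbrakk>c \<in> Ob C; d \<in> Ob C\<rbrakk> \<Longrightarrow> \<tau> (c, d) \<in> Fo P (c, d) \<rightarrow> Fo Q (c, d)"
    and natural: "\<lbrakk>c \<in> Ob C; c' \<in> Ob C; d \<in> Ob C; d' \<in> Ob C;
        f \<in> Hom C c' c; g \<in> Hom C d d'; p \<in> Fo P (c, d)\<rbrakk>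
      \<Longrightarrow> \<tau> (c', d') (Fm P (c, d) (c', d') (f, g) p)
        = Fm Q (c, d) (c', d') (f, g) (\<tau> (c, d) p)"

definition prof_hcomp ::
  "('o, 'm, 'z) cat_scheme
    \<Rightarrow> ('o, 'm, 'p) endoprof \<Rightarrow> ('o, 'm, 'q) endoprof
    \<Rightarrow> ('o, 'm, 'r) endoprof \<Rightarrow> ('o, 'm, 's) endoprof
    \<Rightarrow> ('o \<times> 'o \<Rightarrow> 'p \<Rightarrow> 'r) \<Rightarrow> ('o \<times> 'o \<Rightarrow> 'q \<Rightarrow> 's)
    \<Rightarrow> 'o \<times> 'o \<Rightarrow> ('o \<times> 'p \<times> 'q) set \<Rightarrow> ('o \<times> 'r \<times> 's) set" where
  "prof_hcomp C P Q P' Q' \<sigma> \<tau> = (\<lambda>(c, e).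
     coend_map C (prof_comp_integrand C P Q c e) (prof_comp_integrand C P' Q' c e)
       (\<lambda>d (p, q). (\<sigma> (c, d) p, \<tau> (d, e) q)))"

definition prof_id :: "'o \<times> 'o \<Rightarrow> 'p \<Rightarrow> 'p" where
  "prof_id = (\<lambda>cd p. p)"

definition prof_assoc ::
  "('o, 'm, 'z) cat_scheme
    \<Rightarrow> ('o, 'm, 'p) endoprof \<Rightarrow> ('o, 'm, 'q) endoprof \<Rightarrow> ('o, 'm, 'r) endoprof \<Rightarrow> 'o \<times> 'o
    \<Rightarrow> ('o \<times> ('o \<times> 'p \<times> 'q) set \<times> 'r) set \<Rightarrow> ('o \<times> 'p \<times> ('o \<times> 'q \<times> 'r) set) set" where
  "prof_assoc C P Q R = (\<lambda>(c, e).
     coend_case (\<lambda>d2 (T, r).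
       coend_case (\<lambda>d1 (p, q).
         coend_inj C (prof_comp_integrand C P (prof_comp C Q R) c e) d1
           (p, coend_inj C (prof_comp_integrand C Q R d1 e) d2 (q, r))) T))"

definition prof_lunit ::
  "('o, 'm, 'z) cat_scheme \<Rightarrow> ('o, 'm, 'p) endoprof
    \<Rightarrow> 'o \<times> 'o \<Rightarrow> ('o \<times> 'm \<times> 'p) set \<Rightarrow> 'p" where
  "prof_lunit C P = (\<lambda>(c, e). coend_case (\<lambda>d (f, p). Fm P (d, e) (c, e) (f, Idn C e) p))"

definition prof_runit ::
  "('o, 'm, 'z) cat_scheme \<Rightarrow> ('o, 'm, 'p) endoprof
    \<Rightarrow> 'o \<times> 'o \<Rightarrow> ('o \<times> 'p \<times> 'm) set \<Rightarrow> 'p" where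
  "prof_runit C P = (\<lambda>(c, e). coend_case (\<lambda>d (p, f). Fm P (c, d) (c, e) (Idn C c, f) p))"

text \<open>
  A monoid in endoprofunctors. Composition of profunctors is associative and unital only up to
  the canonical bijections \<open>prof_assoc\<close>, \<open>prof_lunit\<close>, \<open>prof_runit\<close>, and it changes the
  element type, so the monoid laws are stated componentwise.
\<close>

locale promonad = category C + is_functor "prod_cat (op_cat C) C" set_cat P
  + unit: prof_trans C "hom_prof C" P \<eta> + mult: prof_trans C "prof_comp C P P" P \<mu>
  for C :: "('o, 'm, 'z) cat_scheme" and P :: "('o, 'm, 'p) endoprof"
    and \<eta> :: "'o \<times> 'o \<Rightarrow> 'm \<Rightarrow> 'p"
    and \<mu> :: "'o \<times> 'o \<Rightarrow> ('o \<times> 'p \<times> 'p) set \<Rightarrow> 'p" +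
  assumes mult_assoc: "\<lbrakk>c \<in> Ob C; e \<in> Ob C; T \<in> Fo (prof_comp C (prof_comp C P P) P) (c, e)\<rbrakk>
      \<Longrightarrow> \<mu> (c, e) (prof_hcomp C (prof_comp C P P) P P P \<mu> prof_id (c, e) T)
        = \<mu> (c, e) (prof_hcomp C P (prof_comp C P P) P P prof_id \<mu> (c, e)
            (prof_assoc C P P P (c, e) T))"
    and mult_unit_left: "\<lbrakk>c \<in> Ob C; e \<in> Ob C; U \<in> Fo (prof_comp C (hom_prof C) P) (c, e)\<rbrakk>
      \<Longrightarrow> \<mu> (c, e) (prof_hcomp C (hom_prof C) P P P \<eta> prof_id (c, e) U)
        = prof_lunit C P (c, e) U"
    and mult_unit_right: "\<lbrakk>c \<in> Ob C; e \<in> Ob C; V \<in> Fo (prof_comp C P (hom_prof C)) (c, e)\<rbrakk>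
      \<Longrightarrow> \<mu> (c, e) (prof_hcomp C P (hom_prof C) P P prof_id \<eta> (c, e) V)
        = prof_runit C P (c, e) V"

definition kleisli ::
  "('o, 'm, 'z) cat_scheme \<Rightarrow> ('o, 'm, 'p) endoprof
    \<Rightarrow> ('o \<times> 'o \<Rightarrow> 'm \<Rightarrow> 'p) \<Rightarrow> ('o \<times> 'o \<Rightarrow> ('o \<times> 'p \<times> 'p) set \<Rightarrow> 'p) \<Rightarrow> ('o, 'p) cat" where
  "kleisli C P \<eta> \<mu> = \<lparr>Ob = Ob C, Hom = (\<lambda>c d. Fo P (c, d)),
     Idn = (\<lambda>c. \<eta> (c, c) (Idn C c)),
     Cmp = (\<lambda>c d e q p. \<mu> (c, e) (coend_inj C (prof_comp_integrand C P P c e) d (p, q)))\<rparr>"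

section \<open>Bimodular categories\<close>

locale left_action = M: strict_monoidal M + C: category C + is_functor "prod_cat M C" C L
  for M :: "('mo, 'mm, 'z1) moncat_scheme" and C :: "('o, 'm, 'z2) cat_scheme"
    and L :: "('mo \<times> 'o, 'mm \<times> 'm, 'o, 'm) func" +
  assumes unit_ob: "x \<in> Ob C \<Longrightarrow> Fo L (Unt M, x) = x"
    and unit_ar: "\<lbrakk>x \<in> Ob C; y \<in> Ob C; h \<in> Hom C x y\<rbrakk>
      \<Longrightarrow> Fm L (Unt M, x) (Unt M, y) (Idn M (Unt M), h) = h"
    and mult_ob: "\<lbrakk>a \<in> Ob M; b \<in> Ob M; x \<in> Ob C\<rbrakk>
      \<Longrightarrow> Fo L (a, Fo L (b, x)) = Fo L (ten_ob M a b, x)"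
    and mult_ar: "\<lbrakk>a \<in> Ob M; a' \<in> Ob M; b \<in> Ob M; b' \<in> Ob M; x \<in> Ob C; y \<in> Ob C;
        f \<in> Hom M a a'; g \<in> Hom M b b'; h \<in> Hom C x y\<rbrakk>
      \<Longrightarrow> Fm L (a, Fo L (b, x)) (a', Fo L (b', y)) (f, Fm L (b, x) (b', y) (g, h))
        = Fm L (ten_ob M a b, x) (ten_ob M a' b', y) (ten_ar M a a' b b' f g, h)"

locale right_action = C: category C + N: strict_monoidal N + is_functor "prod_cat C N" C R
  for C :: "('o, 'm, 'z1) cat_scheme" and N :: "('no, 'nm, 'z2) moncat_scheme"
    and R :: "('o \<times> 'no, 'm \<times> 'nm, 'o, 'm) func" +
  assumes unit_ob: "x \<in> Ob C \<Longrightarrow> Fo R (x, Unt N) = x"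
    and unit_ar: "\<lbrakk>x \<in> Ob C; y \<in> Ob C; h \<in> Hom C x y\<rbrakk>
      \<Longrightarrow> Fm R (x, Unt N) (y, Unt N) (h, Idn N (Unt N)) = h"
    and mult_ob: "\<lbrakk>x \<in> Ob C; a \<in> Ob N; b \<in> Ob N\<rbrakk>
      \<Longrightarrow> Fo R (Fo R (x, a), b) = Fo R (x, ten_ob N a b)"
    and mult_ar: "\<lbrakk>x \<in> Ob C; y \<in> Ob C; a \<in> Ob N; a' \<in> Ob N; b \<in> Ob N; b' \<in> Ob N;
        h \<in> Hom C x y; f \<in> Hom N a a'; g \<in> Hom N b b'\<rbrakk>
      \<Longrightarrow> Fm R (Fo R (x, a), b) (Fo R (y, a'), b') (Fm R (x, a) (y, a') (h, f), g)
        = Fm R (x, ten_ob N a b) (y, ten_ob N a' b') (h, ten_ar N a a' b b' f g)"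

locale bimodular = left: left_action M C L + right: right_action C N R
  for M :: "('mo, 'mm, 'z1) moncat_scheme" and N :: "('no, 'nm, 'z2) moncat_scheme"
    and C :: "('o, 'm, 'z3) cat_scheme"
    and L :: "('mo \<times> 'o, 'mm \<times> 'm, 'o, 'm) func"
    and R :: "('o \<times> 'no, 'm \<times> 'nm, 'o, 'm) func" +
  assumes compat_ob: "\<lbrakk>a \<in> Ob M; x \<in> Ob C; n \<in> Ob N\<rbrakk>
      \<Longrightarrow> Fo L (a, Fo R (x, n)) = Fo R (Fo L (a, x), n)"
    and compat_ar: "\<lbrakk>a \<in> Ob M; a' \<in> Ob M; x \<in> Ob C; x' \<in> Ob C; n \<in> Ob N; n' \<in> Ob N;
        f \<in> Hom M a a'; h \<in> Hom C x x'; g \<in> Hom N n n'\<rbrakk>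
      \<Longrightarrow> Fm L (a, Fo R (x, n)) (a', Fo R (x', n')) (f, Fm R (x, n) (x', n') (h, g))
        = Fm R (Fo L (a, x), n) (Fo L (a', x'), n') (Fm L (a, x) (a', x') (f, h), g)"

section \<open>The promonad on \<open>A \<times> X\<close>\<close>

definition rtimes_integrand ::
  "('ao, 'am, 'z1) moncat_scheme \<Rightarrow> ('xo, 'xm, 'z2) moncat_scheme \<Rightarrow> ('xo, 'xm, 'ao, 'am) func
    \<Rightarrow> 'ao \<times> 'xo \<Rightarrow> 'ao \<times> 'xo \<Rightarrow> ('xo, 'xm, 'am \<times> 'xm) endoprof" where
  "rtimes_integrand A X F = (\<lambda>(a, x) (b, y).
     \<lparr>Fo = (\<lambda>(m', m). Hom A a (ten_ob A b (Fo F m)) \<times> Hom X (ten_ob X m' x) y),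
      Fm = (\<lambda>(m', m) (n', n) (u, v).
        \<lambda>(s, t) \<in> Hom A a (ten_ob A b (Fo F m)) \<times> Hom X (ten_ob X m' x) y.
          (Cmp A a (ten_ob A b (Fo F m)) (ten_ob A b (Fo F n))
             (ten_ar A b b (Fo F m) (Fo F n) (Idn A b) (Fm F m n v)) s,
           Cmp X (ten_ob X n' x) (ten_ob X m' x) y
             t (ten_ar X n' m' x x u (Idn X x))))\<rparr>)"

definition rtimes ::
  "('ao, 'am, 'z1) moncat_scheme \<Rightarrow> ('xo, 'xm, 'z2) moncat_scheme \<Rightarrow> ('xo, 'xm, 'ao, 'am) func
    \<Rightarrow> ('ao \<times> 'xo, 'am \<times> 'xm, ('xo \<times> 'am \<times> 'xm) set) endoprof" where
  "rtimes A X F =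
     \<lparr>Fo = (\<lambda>(c, d). coend X (rtimes_integrand A X F c d)),
      Fm = (\<lambda>((a, x), (b, y)) ((a', x'), (b', y')) ((f, g), (h, k)).
        coend_map X (rtimes_integrand A X F (a, x) (b, y)) (rtimes_integrand A X F (a', x') (b', y'))
          (\<lambda>m (s, t).
            (Cmp A a' (ten_ob A b (Fo F m)) (ten_ob A b' (Fo F m))
               (ten_ar A b b' (Fo F m) (Fo F m) h (Idn A (Fo F m)))
               (Cmp A a' a (ten_ob A b (Fo F m)) s f),
             Cmp X (ten_ob X m x') y y' k
               (Cmp X (ten_ob X m x') (ten_ob X m x) y
                  t (ten_ar X m m x' x (Idn X m) g)))))\<rparr>"

definition rtimes_unit ::
  "('ao, 'am, 'z1) moncat_scheme \<Rightarrow> ('xo, 'xm, 'z2) moncat_scheme \<Rightarrow> ('xo, 'xm, 'ao, 'am) func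
    \<Rightarrow> 'am \<Rightarrow> ('ao \<times> 'xo) \<times> ('ao \<times> 'xo) \<Rightarrow> 'am \<times> 'xm \<Rightarrow> ('xo \<times> 'am \<times> 'xm) set" where
  "rtimes_unit A X F \<psi>0 = (\<lambda>((a, x), (b, y)) (f, g).
     coend_inj X (rtimes_integrand A X F (a, x) (b, y)) (Unt X)
       (Cmp A a b (ten_ob A b (Fo F (Unt X)))
          (ten_ar A b b (Unt A) (Fo F (Unt X)) (Idn A b) \<psi>0) f, g))"

text \<open>
  On representatives \<open>s : a \<rightarrow> b \<otimes> F m\<close>, \<open>t : m \<otimes> x \<rightarrow> y\<close> and
  \<open>s' : b \<rightarrow> c \<otimes> F n\<close>, \<open>t' : n \<otimes> y \<rightarrow> z\<close> the product sits at \<open>n \<otimes> m\<close>, with components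
  \<open>a \<rightarrow> b \<otimes> F m \<rightarrow> c \<otimes> F n \<otimes> F m \<rightarrow> c \<otimes> F (n \<otimes> m)\<close> and \<open>n \<otimes> m \<otimes> x \<rightarrow> n \<otimes> y \<rightarrow> z\<close>.
\<close>

definition rtimes_mult ::
  "('ao, 'am, 'z1) moncat_scheme \<Rightarrow> ('xo, 'xm, 'z2) moncat_scheme \<Rightarrow> ('xo, 'xm, 'ao, 'am) func
    \<Rightarrow> ('xo \<times> 'xo \<Rightarrow> 'am) \<Rightarrow> ('ao \<times> 'xo) \<times> ('ao \<times> 'xo)
    \<Rightarrow> (('ao \<times> 'xo) \<times> ('xo \<times> 'am \<times> 'xm) set \<times> ('xo \<times> 'am \<times> 'xm) set) set
    \<Rightarrow> ('xo \<times> 'am \<times> 'xm) set" where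
  "rtimes_mult A X F \<psi>2 = (\<lambda>((a, x), (c, z)).
     coend_case (\<lambda>(b, y) (p, q).
       coend_case (\<lambda>m (s, t). coend_case (\<lambda>n (s', t').
         coend_inj X (rtimes_integrand A X F (a, x) (c, z)) (ten_ob X n m)
           (Cmp A a (ten_ob A b (Fo F m)) (ten_ob A c (Fo F (ten_ob X n m)))
              (Cmp A (ten_ob A b (Fo F m)) (ten_ob A c (ten_ob A (Fo F n) (Fo F m)))
                 (ten_ob A c (Fo F (ten_ob X n m)))
                 (ten_ar A c c (ten_ob A (Fo F n) (Fo F m)) (Fo F (ten_ob X n m))
                    (Idn A c) (\<psi>2 (n, m)))
                 (ten_ar A b (ten_ob A c (Fo F n)) (Fo F m) (Fo F m) s' (Idn A (Fo F m))))
              s,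
            Cmp X (ten_ob X n (ten_ob X m x)) (ten_ob X n y) z
              t' (ten_ar X n n (ten_ob X m x) y (Idn X n) t))) q) p))"

definition rtimes_kleisli ::
  "('ao, 'am, 'z1) moncat_scheme \<Rightarrow> ('xo, 'xm, 'z2) moncat_scheme \<Rightarrow> ('xo, 'xm, 'ao, 'am) func
    \<Rightarrow> 'am \<Rightarrow> ('xo \<times> 'xo \<Rightarrow> 'am) \<Rightarrow> ('ao \<times> 'xo, ('xo \<times> 'am \<times> 'xm) set) cat" where
  "rtimes_kleisli A X F \<psi>0 \<psi>2 =
     kleisli (prod_cat A X) (rtimes A X F) (rtimes_unit A X F \<psi>0) (rtimes_mult A X F \<psi>2)"

definition rtimes_left_act ::
  "('ao, 'am, 'z1) moncat_scheme \<Rightarrow> ('xo, 'xm, 'z2) moncat_scheme \<Rightarrow> ('xo, 'xm, 'ao, 'am) func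
    \<Rightarrow> ('ao \<times> ('ao \<times> 'xo), 'am \<times> ('xo \<times> 'am \<times> 'xm) set, 'ao \<times> 'xo, ('xo \<times> 'am \<times> 'xm) set) func" where
  "rtimes_left_act A X F =
     \<lparr>Fo = (\<lambda>(a', (a, x)). (ten_ob A a' a, x)),
      Fm = (\<lambda>(a', (a, x)) (b', (b, y)) (f, T).
        coend_map X (rtimes_integrand A X F (a, x) (b, y))
          (rtimes_integrand A X F (ten_ob A a' a, x) (ten_ob A b' b, y))
          (\<lambda>m (s, t). (ten_ar A a' b' a (ten_ob A b (Fo F m)) f s, t)) T)\<rparr>"

definition rtimes_right_act ::
  "('ao, 'am, 'z1) moncat_scheme \<Rightarrow> ('xo, 'xm, 'z2) moncat_scheme \<Rightarrow> ('xo, 'xm, 'ao, 'am) func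
    \<Rightarrow> (('ao \<times> 'xo) \<times> 'xo, ('xo \<times> 'am \<times> 'xm) set \<times> 'xm, 'ao \<times> 'xo, ('xo \<times> 'am \<times> 'xm) set) func" where
  "rtimes_right_act A X F =
     \<lparr>Fo = (\<lambda>((a, x), x'). (a, ten_ob X x x')),
      Fm = (\<lambda>((a, x), x') ((b, y), y') (T, g).
        coend_map X (rtimes_integrand A X F (a, x) (b, y))
          (rtimes_integrand A X F (a, ten_ob X x x') (b, ten_ob X y y'))
          (\<lambda>m (s, t). (s, ten_ar X (ten_ob X m x) y x' y' t g)) T)\<rparr>"

section \<open>The promonad on \<open>X \<times> A\<close>\<close>

definition ltimes_integrand ::
  "('xo, 'xm, 'z1) moncat_scheme \<Rightarrow> ('ao, 'am, 'z2) moncat_scheme \<Rightarrow> ('xo, 'xm, 'ao, 'am) func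
    \<Rightarrow> 'xo \<times> 'ao \<Rightarrow> 'xo \<times> 'ao \<Rightarrow> ('xo, 'xm, 'am \<times> 'xm) endoprof" where
  "ltimes_integrand X A F = (\<lambda>(x, a) (y, b).
     \<lparr>Fo = (\<lambda>(m', m). Hom A a (ten_ob A (Fo F m) b) \<times> Hom X (ten_ob X x m') y),
      Fm = (\<lambda>(m', m) (n', n) (u, v).
        \<lambda>(s, t) \<in> Hom A a (ten_ob A (Fo F m) b) \<times> Hom X (ten_ob X x m') y.
          (Cmp A a (ten_ob A (Fo F m) b) (ten_ob A (Fo F n) b)
             (ten_ar A (Fo F m) (Fo F n) b b (Fm F m n v) (Idn A b)) s,
           Cmp X (ten_ob X x n') (ten_ob X x m') y
             t (ten_ar X x x n' m' (Idn X x) u)))\<rparr>)"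

definition ltimes ::
  "('xo, 'xm, 'z1) moncat_scheme \<Rightarrow> ('ao, 'am, 'z2) moncat_scheme \<Rightarrow> ('xo, 'xm, 'ao, 'am) func
    \<Rightarrow> ('xo \<times> 'ao, 'xm \<times> 'am, ('xo \<times> 'am \<times> 'xm) set) endoprof" where
  "ltimes X A F =
     \<lparr>Fo = (\<lambda>(c, d). coend X (ltimes_integrand X A F c d)),
      Fm = (\<lambda>((x, a), (y, b)) ((x', a'), (y', b')) ((g, f), (k, h)).
        coend_map X (ltimes_integrand X A F (x, a) (y, b)) (ltimes_integrand X A F (x', a') (y', b'))
          (\<lambda>m (s, t).
            (Cmp A a' (ten_ob A (Fo F m) b) (ten_ob A (Fo F m) b')
               (ten_ar A (Fo F m) (Fo F m) b b' (Idn A (Fo F m)) h)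
               (Cmp A a' a (ten_ob A (Fo F m) b) s f),
             Cmp X (ten_ob X x' m) y y' k
               (Cmp X (ten_ob X x' m) (ten_ob X x m) y
                  t (ten_ar X x' x m m g (Idn X m))))))\<rparr>"

definition ltimes_unit ::
  "('xo, 'xm, 'z1) moncat_scheme \<Rightarrow> ('ao, 'am, 'z2) moncat_scheme \<Rightarrow> ('xo, 'xm, 'ao, 'am) func
    \<Rightarrow> 'am \<Rightarrow> ('xo \<times> 'ao) \<times> ('xo \<times> 'ao) \<Rightarrow> 'xm \<times> 'am \<Rightarrow> ('xo \<times> 'am \<times> 'xm) set" where
  "ltimes_unit X A F \<psi>0 = (\<lambda>((x, a), (y, b)) (g, f).
     coend_inj X (ltimes_integrand X A F (x, a) (y, b)) (Unt X)
       (Cmp A a b (ten_ob A (Fo F (Unt X)) b)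
          (ten_ar A (Unt A) (Fo F (Unt X)) b b \<psi>0 (Idn A b)) f, g))"

text \<open>
  On representatives \<open>s : a \<rightarrow> F m \<otimes> b\<close>, \<open>t : x \<otimes> m \<rightarrow> y\<close> and
  \<open>s' : b \<rightarrow> F n \<otimes> c\<close>, \<open>t' : y \<otimes> n \<rightarrow> z\<close> the product sits at \<open>m \<otimes> n\<close>, with components
  \<open>a \<rightarrow> F m \<otimes> b \<rightarrow> F m \<otimes> F n \<otimes> c \<rightarrow> F (m \<otimes> n) \<otimes> c\<close> and \<open>x \<otimes> m \<otimes> n \<rightarrow> y \<otimes> n \<rightarrow> z\<close>.
\<close>

definition ltimes_mult ::
  "('xo, 'xm, 'z1) moncat_scheme \<Rightarrow> ('ao, 'am, 'z2) moncat_scheme \<Rightarrow> ('xo, 'xm, 'ao, 'am) func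
    \<Rightarrow> ('xo \<times> 'xo \<Rightarrow> 'am) \<Rightarrow> ('xo \<times> 'ao) \<times> ('xo \<times> 'ao)
    \<Rightarrow> (('xo \<times> 'ao) \<times> ('xo \<times> 'am \<times> 'xm) set \<times> ('xo \<times> 'am \<times> 'xm) set) set
    \<Rightarrow> ('xo \<times> 'am \<times> 'xm) set" where
  "ltimes_mult X A F \<psi>2 = (\<lambda>((x, a), (z, c)).
     coend_case (\<lambda>(y, b) (p, q).
       coend_case (\<lambda>m (s, t). coend_case (\<lambda>n (s', t').
         coend_inj X (ltimes_integrand X A F (x, a) (z, c)) (ten_ob X m n)
           (Cmp A a (ten_ob A (Fo F m) b) (ten_ob A (Fo F (ten_ob X m n)) c)
              (Cmp A (ten_ob A (Fo F m) b) (ten_ob A (ten_ob A (Fo F m) (Fo F n)) c)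
                 (ten_ob A (Fo F (ten_ob X m n)) c)
                 (ten_ar A (ten_ob A (Fo F m) (Fo F n)) (Fo F (ten_ob X m n)) c c
                    (\<psi>2 (m, n)) (Idn A c))
                 (ten_ar A (Fo F m) (Fo F m) b (ten_ob A (Fo F n) c) (Idn A (Fo F m)) s'))
              s,
            Cmp X (ten_ob X (ten_ob X x m) n) (ten_ob X y n) z
              t' (ten_ar X (ten_ob X x m) y n n t (Idn X n)))) q) p))"

definition ltimes_kleisli ::
  "('xo, 'xm, 'z1) moncat_scheme \<Rightarrow> ('ao, 'am, 'z2) moncat_scheme \<Rightarrow> ('xo, 'xm, 'ao, 'am) func
    \<Rightarrow> 'am \<Rightarrow> ('xo \<times> 'xo \<Rightarrow> 'am) \<Rightarrow> ('xo \<times> 'ao, ('xo \<times> 'am \<times> 'xm) set) cat" where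
  "ltimes_kleisli X A F \<psi>0 \<psi>2 =
     kleisli (prod_cat X A) (ltimes X A F) (ltimes_unit X A F \<psi>0) (ltimes_mult X A F \<psi>2)"

definition ltimes_left_act ::
  "('xo, 'xm, 'z1) moncat_scheme \<Rightarrow> ('ao, 'am, 'z2) moncat_scheme \<Rightarrow> ('xo, 'xm, 'ao, 'am) func
    \<Rightarrow> ('xo \<times> ('xo \<times> 'ao), 'xm \<times> ('xo \<times> 'am \<times> 'xm) set, 'xo \<times> 'ao, ('xo \<times> 'am \<times> 'xm) set) func" where
  "ltimes_left_act X A F =
     \<lparr>Fo = (\<lambda>(x', (x, a)). (ten_ob X x' x, a)),
      Fm = (\<lambda>(x', (x, a)) (y', (y, b)) (g, T).
        coend_map X (ltimes_integrand X A F (x, a) (y, b))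
          (ltimes_integrand X A F (ten_ob X x' x, a) (ten_ob X y' y, b))
          (\<lambda>m (s, t). (s, ten_ar X x' y' (ten_ob X x m) y g t)) T)\<rparr>"

definition ltimes_right_act ::
  "('xo, 'xm, 'z1) moncat_scheme \<Rightarrow> ('ao, 'am, 'z2) moncat_scheme \<Rightarrow> ('xo, 'xm, 'ao, 'am) func
    \<Rightarrow> (('xo \<times> 'ao) \<times> 'ao, ('xo \<times> 'am \<times> 'xm) set \<times> 'am, 'xo \<times> 'ao, ('xo \<times> 'am \<times> 'xm) set) func" where
  "ltimes_right_act X A F =
     \<lparr>Fo = (\<lambda>((x, a), a'). (x, ten_ob A a a')),
      Fm = (\<lambda>((x, a), a') ((y, b), b') (T, f).
        coend_map X (ltimes_integrand X A F (x, a) (y, b))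
          (ltimes_integrand X A F (x, ten_ob A a a') (y, ten_ob A b b'))
          (\<lambda>m (s, t). (ten_ar A a (ten_ob A (Fo F m) b) a' b' s f, t)) T)\<rparr>"

end

theory Submission
  imports Defs
begin

text \<open>
  A category with the same objects as \<open>C\<close>, together with an identity-on-objects functor from
  \<open>C\<close> into it, is the same thing as a promonad on \<open>C\<close>. It is therefore enough to make the classes
  \<open>[m, s, t]\<close> with \<open>s : a \<rightarrow> b \<otimes> F m\<close> and \<open>t : m \<otimes> x \<rightarrow> y\<close> the arrows \<open>(a, x) \<rightarrow> (b, y)\<close> of a
  category: naturality of \<open>\<psi>2\<close> makes their composition well defined on classes, and the coherence
  axioms of \<open>F\<close> give its associativity and unit laws. Arrows of \<open>A\<close> act by tensoring \<open>s\<close> on the left,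
  arrows of \<open>X\<close> by tensoring \<open>t\<close> on the right, and these two operations do not interfere.

  Reversing the tensor products of \<open>X\<close> and \<open>A\<close> turns \<open>F\<close> into a lax monoidal functor again and
  interchanges, up to swapping the components of pairs, the two profunctors; left and right actions
  change places.
\<close>

section \<open>Coends\<close>

text \<open>The laws of a promonad are equations between functions on coends, and
  \<open>coend_case\<close> returns the intended value only for a function that respects the
  generating relation. Checked directly, the multiplication would need this for a coend over pairs
  of objects whose elements are themselves classes over X, and the associator would nest it once
  more. Passing through a category separates the layers: the relation of the outer coend only moves
  an arrow \<open>\<eta> u\<close> across a composite, which is associativity, so the coherence of F
  is confined to the coends over X. The other obstacle is that composites carry their objects as
  arguments while strictness identifies many bracketings of these; hence the small calculus of
  whiskered squares. For the second profunctor, reversal makes the integrands literally equal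
  instead of isomorphic, and only transport is left. The two Kleisli compositions are still compared
  on arrows only, since they eliminate coends over products taken in opposite order.\<close>

definition dinatural ::
  "('o, 'm, 'z) cat_scheme \<Rightarrow> ('o, 'm, 'p) endoprof \<Rightarrow> ('o \<Rightarrow> 'p \<Rightarrow> 'q) \<Rightarrow> bool" where
  "dinatural C H \<phi> \<longleftrightarrow> (\<forall>m \<in> Ob C. \<forall>n \<in> Ob C. \<forall>u \<in> Hom C m n. \<forall>t \<in> Fo H (n, m).
     \<phi> m (Fm H (n, m) (m, m) (u, Idn C m) t) = \<phi> n (Fm H (n, m) (n, n) (Idn C n, u) t))"

lemma equiv_coend_eq: "equiv (coend_carrier C H) (coend_eq C H)"
proof (rule equivI)
  show "refl_on (coend_carrier C H) (coend_eq C H)"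
    by (auto simp: refl_on_def coend_eq_def)
  show "sym (coend_eq C H)"
    unfolding coend_eq_def
    by (intro sym_Int sym_rtrancl) (auto simp: sym_def)
  show "trans (coend_eq C H)"
    unfolding coend_eq_def by (auto intro!: transI)
qed (auto simp: coend_eq_def)

lemma coend_inj_in:
  "\<lbrakk>m \<in> Ob C; t \<in> Fo H (m, m)\<rbrakk> \<Longrightarrow> coend_inj C H m t \<in> coend C H"
  by (auto simp: coend_def coend_inj_def coend_carrier_def intro!: quotientI)

lemma coendE:
  assumes "T \<in> coend C H"
  obtains m t where "m \<in> Ob C" "t \<in> Fo H (m, m)" "T = coend_inj C H m t"
  using assms by (auto simp: coend_def coend_inj_def coend_carrier_def elim!: quotientE)

text \<open>\<open>coend_eq\<close> is the generated equivalence cut down to the carrier, so a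
  generating pair belongs to it only when both ends lie in the carrier. The hypothesis says so;
  functoriality or the typing of composites supplies it below.\<close>

lemma dinatural_coend_inj:
  assumes "\<And>m n u t. \<lbrakk>m \<in> Ob C; n \<in> Ob C; u \<in> Hom C m n; t \<in> Fo H (n, m)\<rbrakk>
      \<Longrightarrow> Fm H (n, m) (m, m) (u, Idn C m) t \<in> Fo H (m, m)
        \<and> Fm H (n, m) (n, n) (Idn C n, u) t \<in> Fo H (n, n)"
  shows "dinatural C H (coend_inj C H)"
  unfolding dinatural_def coend_inj_def
proof (intro ballI equiv_class_eq[OF equiv_coend_eq])
  fix m n u t assume *: "m \<in> Ob C" "n \<in> Ob C" "u \<in> Hom C m n" "t \<in> Fo H (n, m)"
  then have "((m, Fm H (n, m) (m, m) (u, Idn C m) t), (n, Fm H (n, m) (n, n) (Idn C n, u) t))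
    \<in> coend_rel C H"
    unfolding coend_rel_def by blast
  then show "((m, Fm H (n, m) (m, m) (u, Idn C m) t), (n, Fm H (n, m) (n, n) (Idn C n, u) t))
    \<in> coend_eq C H"
    using * assms by (auto simp: coend_eq_def coend_carrier_def)
qed

text \<open>The universal property of the coend: a dinatural family takes one value along every
  zigzag of generating pairs, so its image of a class is a singleton. The zigzag may leave the
  carrier, which is harmless because \<open>dinatural\<close> speaks of all generating
  pairs.\<close>

lemma coend_case_inj:
  assumes "dinatural C H \<phi>" and "m \<in> Ob C" and "t \<in> Fo H (m, m)"
  shows "coend_case \<phi> (coend_inj C H m t) = \<phi> m t"
proof -
  have "case_prod \<phi> p = case_prod \<phi> q" if "(p, q) \<in> (coend_rel C H \<union> (coend_rel C H)\<inverse>)\<^sup>*" for p q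
    using that
  proof (induction rule: rtrancl_induct)
    case (step y z)
    then show ?case
      using assms(1) by (auto simp: coend_rel_def dinatural_def)
  qed simp
  moreover have "(m, t) \<in> coend_inj C H m t"
    using assms by (auto simp: coend_inj_def coend_eq_def coend_carrier_def)
  ultimately have "(\<lambda>(m, t). \<phi> m t) ` coend_inj C H m t = {\<phi> m t}"
    unfolding coend_inj_def coend_eq_def by fastforce
  then show ?thesis
    by (simp add: coend_case_def)
qed

lemma coend_map_inj:
  assumes "dinatural C H (\<lambda>m t. coend_inj C K m (\<theta> m t))" and "m \<in> Ob C" and "t \<in> Fo H (m, m)"
  shows "coend_map C H K \<theta> (coend_inj C H m t) = coend_inj C K m (\<theta> m t)"
  using assms coend_case_inj[OF assms] by (simp add: coend_map_def coend_inj_in)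

section \<open>Profunctors and their composition\<close>

lemma category_op: "category C \<Longrightarrow> category (op_cat C)"
  by (auto simp: category_def op_cat_def)

lemma category_prod: "category C \<Longrightarrow> category D \<Longrightarrow> category (prod_cat C D)"
  by (simp add: category_def prod_cat_def)

lemma category_set_cat: "category set_cat"
proof
  fix a b c d :: "'a set" and f g h :: "'a \<Rightarrow> 'a"
  show "a \<in> Ob set_cat \<Longrightarrow> Idn set_cat a \<in> Hom set_cat a a"
    by (auto simp: set_cat_def)
  show "f \<in> Hom set_cat a b \<Longrightarrow> g \<in> Hom set_cat b c \<Longrightarrow> Cmp set_cat a b c g f \<in> Hom set_cat a c"
    by (auto simp: set_cat_def compose_def)
  show "f \<in> Hom set_cat a b \<Longrightarrow> Cmp set_cat a a b f (Idn set_cat a) = f"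
    by (auto simp: set_cat_def compose_def fun_eq_iff PiE_def extensional_def)
  show "f \<in> Hom set_cat a b \<Longrightarrow> Cmp set_cat a b b (Idn set_cat b) f = f"
    by (auto simp: set_cat_def compose_def fun_eq_iff PiE_def extensional_def Pi_def)
  show "f \<in> Hom set_cat a b \<Longrightarrow> g \<in> Hom set_cat b c \<Longrightarrow> h \<in> Hom set_cat c d \<Longrightarrow>
    Cmp set_cat a c d h (Cmp set_cat a b c g f) = Cmp set_cat a b d (Cmp set_cat b c d h g) f"
    by (auto simp: set_cat_def compose_def fun_eq_iff PiE_def extensional_def Pi_def)
qed

text \<open>Arrows of \<open>set_cat\<close> are extensional functions, so once the action lies in
  \<open>\<rightarrow>\<^sub>E\<close> functoriality can be checked on elements. The first argument
  is contravariant, hence the reversed composite in the last premise.\<close>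

lemma endoprofunctorI:
  assumes "category C"
    and "\<And>c d c' d' f g. \<lbrakk>c \<in> Ob C; d \<in> Ob C; c' \<in> Ob C; d' \<in> Ob C; f \<in> Hom C c' c; g \<in> Hom C d d'\<rbrakk>
      \<Longrightarrow> Fm P (c, d) (c', d') (f, g) \<in> Fo P (c, d) \<rightarrow>\<^sub>E Fo P (c', d')"
    and "\<And>c d p. \<lbrakk>c \<in> Ob C; d \<in> Ob C; p \<in> Fo P (c, d)\<rbrakk>
      \<Longrightarrow> Fm P (c, d) (c, d) (Idn C c, Idn C d) p = p"
    and "\<And>c d c' d' c'' d'' f g f' g' p. \<lbrakk>c \<in> Ob C; d \<in> Ob C; c' \<in> Ob C; d' \<in> Ob C;
        c'' \<in> Ob C; d'' \<in> Ob C; f \<in> Hom C c' c; g \<in> Hom C d d'; f' \<in> Hom C c'' c'; g' \<in> Hom C d' d'';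
        p \<in> Fo P (c, d)\<rbrakk>
      \<Longrightarrow> Fm P (c, d) (c'', d'') (Cmp C c'' c' c f f', Cmp C d d' d'' g' g) p
        = Fm P (c', d') (c'', d'') (f', g') (Fm P (c, d) (c', d') (f, g) p)"
  shows "endoprofunctor C P"
proof (intro is_functor.intro category_prod category_op category_set_cat assms(1)
    is_functor_axioms.intro, goal_cases)
  case (3 a)
  obtain c d where a: "a = (c, d)" by (cases a)
  have "Fm P (c, d) (c, d) (Idn C c, Idn C d) = (\<lambda>p \<in> Fo P (c, d). p)"
  proof (rule PiE_ext)
    show "Fm P (c, d) (c, d) (Idn C c, Idn C d) \<in> Fo P (c, d) \<rightarrow>\<^sub>E Fo P (c, d)"
      using 3 assms(1,2) by (auto simp: a prod_cat_def op_cat_def category_def)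
  qed (use 3 assms(3) in \<open>auto simp: a prod_cat_def op_cat_def\<close>)
  then show ?case
    by (simp add: a prod_cat_def op_cat_def set_cat_def)
next
  case (4 a b c fg fg')
  obtain a1 a2 b1 b2 c1 c2 f g f' g' where
    eqs: "a = (a1, a2)" "b = (b1, b2)" "c = (c1, c2)" "fg = (f, g)" "fg' = (f', g')"
    by (cases a, cases b, cases c, cases fg, cases fg')
  have hyps: "a1 \<in> Ob C" "a2 \<in> Ob C" "b1 \<in> Ob C" "b2 \<in> Ob C" "c1 \<in> Ob C" "c2 \<in> Ob C"
    "f \<in> Hom C b1 a1" "g \<in> Hom C a2 b2" "f' \<in> Hom C c1 b1" "g' \<in> Hom C b2 c2"
    using 4 by (auto simp: eqs prod_cat_def op_cat_def)
  have "Fm P (a1, a2) (c1, c2) (Cmp C c1 b1 a1 f f', Cmp C a2 b2 c2 g' g)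
    = compose (Fo P (a1, a2)) (Fm P (b1, b2) (c1, c2) (f', g')) (Fm P (a1, a2) (b1, b2) (f, g))"
  proof (rule PiE_ext)
    show "Fm P (a1, a2) (c1, c2) (Cmp C c1 b1 a1 f f', Cmp C a2 b2 c2 g' g)
      \<in> Fo P (a1, a2) \<rightarrow>\<^sub>E Fo P (c1, c2)"
      using hyps assms(1) by (intro assms(2)) (auto simp: category_def)
    show "compose (Fo P (a1, a2)) (Fm P (b1, b2) (c1, c2) (f', g')) (Fm P (a1, a2) (b1, b2) (f, g))
      \<in> Fo P (a1, a2) \<rightarrow>\<^sub>E Fo P (c1, c2)"
      using assms(2)[of a1 a2 b1 b2 f g] assms(2)[of b1 b2 c1 c2 f' g'] hyps
      by (auto simp: compose_def)
  qed (use hyps assms(4) in \<open>auto simp: compose_def\<close>)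
  then show ?case
    by (simp add: eqs prod_cat_def op_cat_def set_cat_def)
next
  case (2 a b fg)
  then show ?case
    using assms(2)[of "fst a" "snd a" "fst b" "snd b" "fst fg" "snd fg"]
    by (simp add: prod_cat_def op_cat_def set_cat_def mem_Times_iff)
qed (simp add: set_cat_def)

lemma endoprofunctor_act:
  assumes "endoprofunctor C P" "c \<in> Ob C" "d \<in> Ob C" "c' \<in> Ob C" "d' \<in> Ob C"
    "f \<in> Hom C c' c" "g \<in> Hom C d d'"
  shows "Fm P (c, d) (c', d') (f, g) \<in> Fo P (c, d) \<rightarrow>\<^sub>E Fo P (c', d')"
  using is_functor.Fm_in[OF assms(1), of "(c, d)" "(c', d')" "(f, g)"] assms(2-)
  by (simp add: prod_cat_def op_cat_def set_cat_def)

lemma endoprofunctor_in: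
  "\<lbrakk>endoprofunctor C P; c \<in> Ob C; d \<in> Ob C; c' \<in> Ob C; d' \<in> Ob C;
    f \<in> Hom C c' c; g \<in> Hom C d d'; p \<in> Fo P (c, d)\<rbrakk>
   \<Longrightarrow> Fm P (c, d) (c', d') (f, g) p \<in> Fo P (c', d')"
  by (rule PiE_mem[OF endoprofunctor_act])

lemma endoprofunctor_idn:
  assumes "endoprofunctor C P" "c \<in> Ob C" "d \<in> Ob C" "p \<in> Fo P (c, d)"
  shows "Fm P (c, d) (c, d) (Idn C c, Idn C d) p = p"
  using is_functor.Fm_idn[OF assms(1), of "(c, d)"] assms(2-)
  by (simp add: prod_cat_def op_cat_def set_cat_def)

lemma endoprofunctor_cmp:
  assumes "endoprofunctor C P" "c \<in> Ob C" "d \<in> Ob C" "c' \<in> Ob C" "d' \<in> Ob C"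
    "c'' \<in> Ob C" "d'' \<in> Ob C" "f \<in> Hom C c' c" "g \<in> Hom C d d'" "f' \<in> Hom C c'' c'" "g' \<in> Hom C d' d''"
    "p \<in> Fo P (c, d)"
  shows "Fm P (c', d') (c'', d'') (f', g') (Fm P (c, d) (c', d') (f, g) p)
    = Fm P (c, d) (c'', d'') (Cmp C c'' c' c f f', Cmp C d d' d'' g' g) p"
  using is_functor.Fm_cmp[OF assms(1), of "(c, d)" "(c', d')" "(c'', d'')" "(f, g)" "(f', g')"] assms(2-)
  by (simp add: prod_cat_def op_cat_def set_cat_def compose_def)

text \<open>The identity halves of the two actions vanish by functoriality of \<open>P\<close> and
  \<open>Q\<close>. What remains is the balancing condition of a tensor product over
  \<open>C\<close>: an arrow \<open>u\<close> passes from the right factor to the left one.\<close>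

lemma dinatural_prof_comp_integrand:
  assumes C: "category C" and P: "endoprofunctor C P" and Q: "endoprofunctor C Q" and "c \<in> Ob C" "e \<in> Ob C"
  shows "dinatural C (prof_comp_integrand C P Q c e) \<phi> \<longleftrightarrow>
    (\<forall>d \<in> Ob C. \<forall>d' \<in> Ob C. \<forall>u \<in> Hom C d d'. \<forall>p \<in> Fo P (c, d). \<forall>q \<in> Fo Q (d', e).
       \<phi> d (p, Fm Q (d', e) (d, e) (u, Idn C e) q) = \<phi> d' (Fm P (c, d) (c, d') (Idn C c, u) p, q))"
  unfolding dinatural_def prof_comp_integrand_def using assms
  by (auto simp: endoprofunctor_idn)

lemma prof_comp_inj_dinatural:
  assumes "category C" "endoprofunctor C P" "endoprofunctor C Q" "c \<in> Ob C" "e \<in> Ob C"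
  shows "dinatural C (prof_comp_integrand C P Q c e) (coend_inj C (prof_comp_integrand C P Q c e))"
  using assms unfolding prof_comp_integrand_def
  by (intro dinatural_coend_inj)
    (auto simp: category.idn_in intro!: endoprofunctor_in)

lemma prof_comp_inj_balanced:
  assumes "category C" "endoprofunctor C P" "endoprofunctor C Q" "c \<in> Ob C" "e \<in> Ob C"
    "d \<in> Ob C" "d' \<in> Ob C" "u \<in> Hom C d d'" "p \<in> Fo P (c, d)" "q \<in> Fo Q (d', e)"
  shows "coend_inj C (prof_comp_integrand C P Q c e) d (p, Fm Q (d', e) (d, e) (u, Idn C e) q)
    = coend_inj C (prof_comp_integrand C P Q c e) d' (Fm P (c, d) (c, d') (Idn C c, u) p, q)"
  using prof_comp_inj_dinatural[of C P Q c e] assms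
  by (simp add: dinatural_prof_comp_integrand)

lemma Fo_prof_comp: "Fo (prof_comp C P Q) (c, e) = coend C (prof_comp_integrand C P Q c e)"
  by (simp add: prof_comp_def)

lemma Fo_prof_comp_integrand: "Fo (prof_comp_integrand C P Q c e) (d', d) = Fo P (c, d) \<times> Fo Q (d', e)"
  by (simp add: prof_comp_integrand_def)

lemma prof_comp_inj_in:
  "\<lbrakk>d \<in> Ob C; p \<in> Fo P (c, d); q \<in> Fo Q (d, e)\<rbrakk>
   \<Longrightarrow> coend_inj C (prof_comp_integrand C P Q c e) d (p, q) \<in> Fo (prof_comp C P Q) (c, e)"
  by (simp add: Fo_prof_comp coend_inj_in Fo_prof_comp_integrand)

lemma prof_compE:
  assumes "T \<in> Fo (prof_comp C P Q) (c, e)"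
  obtains d p q where "d \<in> Ob C" "p \<in> Fo P (c, d)" "q \<in> Fo Q (d, e)"
    "T = coend_inj C (prof_comp_integrand C P Q c e) d (p, q)"
  using assms by (auto simp: Fo_prof_comp Fo_prof_comp_integrand elim!: coendE)

lemma prof_comp_case_inj:
  assumes "category C" "endoprofunctor C P" "endoprofunctor C Q" "c \<in> Ob C" "e \<in> Ob C"
    and "d \<in> Ob C" "p \<in> Fo P (c, d)" "q \<in> Fo Q (d, e)"
    and "\<And>d d' u p q. \<lbrakk>d \<in> Ob C; d' \<in> Ob C; u \<in> Hom C d d'; p \<in> Fo P (c, d); q \<in> Fo Q (d', e)\<rbrakk>
      \<Longrightarrow> \<phi> d (p, Fm Q (d', e) (d, e) (u, Idn C e) q) = \<phi> d' (Fm P (c, d) (c, d') (Idn C c, u) p, q)"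
  shows "coend_case \<phi> (coend_inj C (prof_comp_integrand C P Q c e) d (p, q)) = \<phi> d (p, q)"
  using assms by (intro coend_case_inj) (auto simp: dinatural_prof_comp_integrand Fo_prof_comp_integrand)

lemma prof_comp_Fm_inj:
  assumes C: "category C" and P: "endoprofunctor C P" and Q: "endoprofunctor C Q"
    and ob: "c \<in> Ob C" "e \<in> Ob C" "c' \<in> Ob C" "e' \<in> Ob C" "f \<in> Hom C c' c" "g \<in> Hom C e e'"
    and dpq: "d \<in> Ob C" "p \<in> Fo P (c, d)" "q \<in> Fo Q (d, e)"
  shows "Fm (prof_comp C P Q) (c, e) (c', e') (f, g) (coend_inj C (prof_comp_integrand C P Q c e) d (p, q))
    = coend_inj C (prof_comp_integrand C P Q c' e') d
        (Fm P (c, d) (c', d) (f, Idn C d) p, Fm Q (d, e) (d, e') (Idn C d, g) q)"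
proof -
  interpret C: category C by fact
  note cmp = endoprofunctor_cmp[OF P] endoprofunctor_cmp[OF Q]
  note ins = endoprofunctor_in[OF P] endoprofunctor_in[OF Q]
  \<comment> \<open>\<open>f\<close> and \<open>u\<close> act on different arguments of
    \<open>P\<close>, and \<open>u\<close> and \<open>g\<close> on different arguments of
    \<open>Q\<close>. Either order of acting merges into the action of one pair, so the outer action
    respects balancing.\<close>
  have "coend_inj C (prof_comp_integrand C P Q c' e') d
      (Fm P (c, d) (c', d) (f, Idn C d) p, Fm Q (d, e) (d, e') (Idn C d, g) (Fm Q (d', e) (d, e) (u, Idn C e) q))
    = coend_inj C (prof_comp_integrand C P Q c' e') d'
      (Fm P (c, d') (c', d') (f, Idn C d') (Fm P (c, d) (c, d') (Idn C c, u) p), Fm Q (d', e) (d', e') (Idn C d', g) q)"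
    if *: "d \<in> Ob C" "d' \<in> Ob C" "u \<in> Hom C d d'" "p \<in> Fo P (c, d)" "q \<in> Fo Q (d', e)" for d d' u p q
    using prof_comp_inj_balanced[OF C P Q ob(3,4), of d d' u "Fm P (c, d) (c', d) (f, Idn C d) p"
        "Fm Q (d', e) (d', e') (Idn C d', g) q"] * ob
    by (simp add: cmp ins C.idn_in C.cmp_idn_left C.cmp_idn_right)
  then show ?thesis
    using ob dpq unfolding prof_comp_def
    by (simp, subst coend_map_inj)
      (simp_all add: dinatural_prof_comp_integrand[OF C P Q] Fo_prof_comp_integrand)
qed

lemma endoprofunctor_prof_comp:
  assumes C: "category C" and P: "endoprofunctor C P" and Q: "endoprofunctor C Q"
  shows "endoprofunctor C (prof_comp C P Q)"
proof (rule endoprofunctorI[OF C])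
  interpret C: category C by fact
  note rules = prof_comp_Fm_inj[OF C P Q] prof_comp_inj_in endoprofunctor_in[OF P] endoprofunctor_in[OF Q]
    endoprofunctor_idn[OF P] endoprofunctor_idn[OF Q] C.idn_in
  {
    fix c d c' d' f g
    assume *: "c \<in> Ob C" "d \<in> Ob C" "c' \<in> Ob C" "d' \<in> Ob C" "f \<in> Hom C c' c" "g \<in> Hom C d d'"
    show "Fm (prof_comp C P Q) (c, d) (c', d') (f, g)
      \<in> Fo (prof_comp C P Q) (c, d) \<rightarrow>\<^sub>E Fo (prof_comp C P Q) (c', d')"
    proof (intro PiE_I)
      fix T assume "T \<in> Fo (prof_comp C P Q) (c, d)"
      then show "Fm (prof_comp C P Q) (c, d) (c', d') (f, g) T \<in> Fo (prof_comp C P Q) (c', d')"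
        by (rule prof_compE) (use * in \<open>simp add: rules\<close>)
    qed (simp add: prof_comp_def coend_map_def)
  next
    fix c d p assume "c \<in> Ob C" "d \<in> Ob C" "p \<in> Fo (prof_comp C P Q) (c, d)"
    then show "Fm (prof_comp C P Q) (c, d) (c, d) (Idn C c, Idn C d) p = p"
      by (auto elim!: prof_compE simp: rules)
  next
    fix c d c' d' c'' d'' f g f' g' T
    assume *: "c \<in> Ob C" "d \<in> Ob C" "c' \<in> Ob C" "d' \<in> Ob C" "c'' \<in> Ob C" "d'' \<in> Ob C"
      "f \<in> Hom C c' c" "g \<in> Hom C d d'" "f' \<in> Hom C c'' c'" "g' \<in> Hom C d' d''"
    assume "T \<in> Fo (prof_comp C P Q) (c, d)"
    then show "Fm (prof_comp C P Q) (c, d) (c'', d'') (Cmp C c'' c' c f f', Cmp C d d' d'' g' g) T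
      = Fm (prof_comp C P Q) (c', d') (c'', d'') (f', g') (Fm (prof_comp C P Q) (c, d) (c', d') (f, g) T)"
      by (rule prof_compE) (use * in \<open>simp add: rules C.cmp_in endoprofunctor_cmp[OF P]
        endoprofunctor_cmp[OF Q] C.cmp_idn_left\<close>)
  }
qed

lemma Fo_hom_prof: "Fo (hom_prof C) (c, d) = Hom C c d"
  by (simp add: hom_prof_def)

lemma Fm_hom_prof: "h \<in> Hom C c d \<Longrightarrow>
    Fm (hom_prof C) (c, d) (c', d') (f, g) h = Cmp C c' d d' g (Cmp C c' c d h f)"
  by (simp add: hom_prof_def)

lemma endoprofunctor_hom_prof:
  assumes "category C"
  shows "endoprofunctor C (hom_prof C)"
proof (rule endoprofunctorI[OF assms])
  interpret category C by fact
  fix c d c' d' c'' d'' f g f' g' p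
  assume "c \<in> Ob C" "d \<in> Ob C" "c' \<in> Ob C" "d' \<in> Ob C" "c'' \<in> Ob C" "d'' \<in> Ob C"
    "f \<in> Hom C c' c" "g \<in> Hom C d d'" "f' \<in> Hom C c'' c'" "g' \<in> Hom C d' d''"
    "p \<in> Fo (hom_prof C) (c, d)"
  then show "Fm (hom_prof C) (c, d) (c'', d'') (Cmp C c'' c' c f f', Cmp C d d' d'' g' g) p
    = Fm (hom_prof C) (c', d') (c'', d'') (f', g') (Fm (hom_prof C) (c, d) (c', d') (f, g) p)"
    by (simp add: hom_prof_def cmp_in cmp_assoc[symmetric])
qed (use assms in \<open>auto simp: hom_prof_def category_def\<close>)

section \<open>Promonads from identity-on-objects functors\<close>

text \<open>An identity-on-objects functor \<open>\<eta>\<close> from \<open>C\<close> to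
  \<open>K\<close>, with \<open>P\<close> the hom-functor of \<open>K\<close> restricted along it.
  \<open>mult_eq\<close> prescribes \<open>\<mu>\<close> only through \<open>coend_case\<close> on
  representatives; that this is well defined is derived, not assumed. \<open>Fm_ext\<close> reflects
  that arrows of \<open>set_cat\<close> are extensional.\<close>

locale identity_on_objects = C: category C + K: category K
  for C :: "('o, 'm, 'z1) cat_scheme" and K :: "('o, 'p, 'z2) cat_scheme"
    and P :: "('o, 'm, 'p) endoprof"
    and \<eta> :: "'o \<times> 'o \<Rightarrow> 'm \<Rightarrow> 'p"
    and \<mu> :: "'o \<times> 'o \<Rightarrow> ('o \<times> 'p \<times> 'p) set \<Rightarrow> 'p" +
  assumes Ob_eq: "Ob K = Ob C"
    and Fo_eq: "Fo P (c, d) = Hom K c d"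
    and unit_in: "\<lbrakk>c \<in> Ob C; d \<in> Ob C; f \<in> Hom C c d\<rbrakk> \<Longrightarrow> \<eta> (c, d) f \<in> Hom K c d"
    and unit_idn: "c \<in> Ob C \<Longrightarrow> \<eta> (c, c) (Idn C c) = Idn K c"
    and unit_cmp: "\<lbrakk>c \<in> Ob C; d \<in> Ob C; e \<in> Ob C; f \<in> Hom C c d; g \<in> Hom C d e\<rbrakk>
      \<Longrightarrow> \<eta> (c, e) (Cmp C c d e g f) = Cmp K c d e (\<eta> (d, e) g) (\<eta> (c, d) f)"
    and Fm_ext: "\<lbrakk>c \<in> Ob C; d \<in> Ob C; c' \<in> Ob C; d' \<in> Ob C; f \<in> Hom C c' c; g \<in> Hom C d d'\<rbrakk>
      \<Longrightarrow> Fm P (c, d) (c', d') (f, g) \<in> extensional (Hom K c d)"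
    and Fm_eq: "\<lbrakk>c \<in> Ob C; d \<in> Ob C; c' \<in> Ob C; d' \<in> Ob C; f \<in> Hom C c' c; g \<in> Hom C d d'; p \<in> Hom K c d\<rbrakk>
      \<Longrightarrow> Fm P (c, d) (c', d') (f, g) p
        = Cmp K c' d d' (\<eta> (d, d') g) (Cmp K c' c d p (\<eta> (c', c) f))"
    and mult_eq: "\<mu> (c, e) = coend_case (\<lambda>d (p, q). Cmp K c d e q p)"
begin

lemmas K_rules = K.idn_in[unfolded Ob_eq] K.cmp_in[unfolded Ob_eq] K.cmp_idn_left[unfolded Ob_eq]
  K.cmp_idn_right[unfolded Ob_eq] K.cmp_assoc[unfolded Ob_eq, symmetric]

lemma endoprofunctor: "endoprofunctor C P"
proof (rule endoprofunctorI[OF C.category_axioms])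
  fix c d c' d' f g
  assume "c \<in> Ob C" "d \<in> Ob C" "c' \<in> Ob C" "d' \<in> Ob C" "f \<in> Hom C c' c" "g \<in> Hom C d d'"
  then show "Fm P (c, d) (c', d') (f, g) \<in> Fo P (c, d) \<rightarrow>\<^sub>E Fo P (c', d')"
    using Fm_ext[of c d c' d' f g] by (auto simp: PiE_iff Fo_eq Fm_eq unit_in K_rules)
qed (simp_all add: Fo_eq Fm_eq unit_in unit_idn unit_cmp K_rules C.idn_in C.cmp_in)

text \<open>The balancing condition reads \<open>(q \<circ> \<eta> u) \<circ> p = q \<circ> (\<eta>
  u \<circ> p)\<close>, so composition is well defined on the coend by associativity in
  \<open>K\<close>.\<close>

lemma mult_inj:
  assumes "c \<in> Ob C" "d \<in> Ob C" "e \<in> Ob C" "p \<in> Hom K c d" "q \<in> Hom K d e"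
  shows "\<mu> (c, e) (coend_inj C (prof_comp_integrand C P P c e) d (p, q)) = Cmp K c d e q p"
  unfolding mult_eq using assms
  by (subst prof_comp_case_inj[OF C.category_axioms endoprofunctor endoprofunctor])
    (simp_all add: Fo_eq Fm_eq unit_in unit_idn K_rules C.idn_in)

text \<open>Naturality of \<open>\<sigma>\<close> and \<open>\<tau>\<close> preserves balancing.
  \<open>P'\<close> and \<open>Q'\<close> are arbitrary because the laws of a promonad put hom
  profunctors and composites in these places.\<close>

lemma prof_hcomp_inj:
  assumes P': "endoprofunctor C P'" and Q': "endoprofunctor C Q'"
    and "prof_trans C P' P \<sigma>" and "prof_trans C Q' P \<tau>"
    and ob: "c \<in> Ob C" "e \<in> Ob C" and dpq: "d \<in> Ob C" "p \<in> Fo P' (c, d)" "q \<in> Fo Q' (d, e)"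
  shows "prof_hcomp C P' Q' P P \<sigma> \<tau> (c, e) (coend_inj C (prof_comp_integrand C P' Q' c e) d (p, q))
    = coend_inj C (prof_comp_integrand C P P c e) d (\<sigma> (c, d) p, \<tau> (d, e) q)"
proof -
  interpret \<sigma>: prof_trans C P' P \<sigma> by fact
  interpret \<tau>: prof_trans C Q' P \<tau> by fact
  note balanced = prof_comp_inj_balanced[OF C.category_axioms endoprofunctor endoprofunctor ob]
  show ?thesis
    unfolding prof_hcomp_def using ob dpq
    by (simp, subst coend_map_inj)
      (simp_all add: dinatural_prof_comp_integrand[OF C.category_axioms P' Q' ob] Fo_prof_comp_integrand
        \<sigma>.natural \<tau>.natural C.idn_in funcset_mem[OF \<sigma>.component_in] funcset_mem[OF \<tau>.component_in]
        balanced)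
qed

lemma prof_id_apply: "prof_id cd p = p"
  by (simp add: prof_id_def)

lemma prof_trans_prof_id: "prof_trans C P P prof_id"
  by (intro prof_trans.intro prof_trans_axioms.intro endoprofunctor C.category_axioms)
    (auto simp: prof_id_def)

lemma prof_trans_unit: "prof_trans C (hom_prof C) P \<eta>"
  by (intro prof_trans.intro prof_trans_axioms.intro endoprofunctor C.category_axioms
      endoprofunctor_hom_prof)
    (auto simp: Fo_hom_prof Fm_hom_prof Fo_eq Fm_eq unit_in unit_cmp C.cmp_in K_rules)

lemma prof_trans_mult: "prof_trans C (prof_comp C P P) P \<mu>"
proof (intro prof_trans.intro prof_trans_axioms.intro endoprofunctor C.category_axioms
      endoprofunctor_prof_comp)
  note C = C.category_axioms and P = endoprofunctor
  fix c d assume *: "c \<in> Ob C" "d \<in> Ob C"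
  then show "\<mu> (c, d) \<in> Fo (prof_comp C P P) (c, d) \<rightarrow> Fo P (c, d)"
    by (auto elim!: prof_compE simp: mult_inj Fo_eq K_rules)
  fix c' d' f g p
  assume **: "c' \<in> Ob C" "d' \<in> Ob C" "f \<in> Hom C c' c" "g \<in> Hom C d d'"
  assume "p \<in> Fo (prof_comp C P P) (c, d)"
  then show "\<mu> (c', d') (Fm (prof_comp C P P) (c, d) (c', d') (f, g) p)
       = Fm P (c, d) (c', d') (f, g) (\<mu> (c, d) p)"
    by (rule prof_compE) (use * ** in \<open>simp add: Fo_eq prof_comp_Fm_inj[OF C P P] mult_inj Fm_eq
      unit_in unit_idn C.idn_in K_rules\<close>)
qed

lemma promonad: "promonad C P \<eta> \<mu>"
proof (intro promonad.intro promonad_axioms.intro C.category_axioms endoprofunctor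
    prof_trans_unit prof_trans_mult)
  note C = C.category_axioms and P = endoprofunctor
  note H = endoprofunctor_hom_prof[OF C] and PP = endoprofunctor_prof_comp[OF C P P]
  fix c e assume ob: "c \<in> Ob C" "e \<in> Ob C"
  {
    fix U assume "U \<in> Fo (prof_comp C (hom_prof C) P) (c, e)"
    then obtain d f p where U: "d \<in> Ob C" "f \<in> Hom C c d" "p \<in> Hom K d e"
      "U = coend_inj C (prof_comp_integrand C (hom_prof C) P c e) d (f, p)"
      by (auto elim!: prof_compE simp: Fo_eq Fo_hom_prof Fm_hom_prof)
    have "prof_lunit C P (c, e) U = Fm P (d, e) (c, e) (f, Idn C e) p"
      using ob U unfolding prof_lunit_def
      by (simp, subst prof_comp_case_inj[OF C H P])
        (simp_all add: Fo_hom_prof Fm_hom_prof Fo_eq Fm_eq C.idn_in C.cmp_in C.cmp_idn_right C.cmp_idn_left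
          unit_in unit_idn unit_cmp K_rules)
    then show "\<mu> (c, e) (prof_hcomp C (hom_prof C) P P P \<eta> prof_id (c, e) U) = prof_lunit C P (c, e) U"
      using ob U
      by (simp add: prof_hcomp_inj[OF H P prof_trans_unit prof_trans_prof_id] Fo_hom_prof Fm_hom_prof Fo_eq
        prof_id_apply mult_inj unit_in Fm_eq C.idn_in unit_idn K_rules)
  next
    fix U assume "U \<in> Fo (prof_comp C P (hom_prof C)) (c, e)"
    then obtain d f p where U: "d \<in> Ob C" "f \<in> Hom C d e" "p \<in> Hom K c d"
      "U = coend_inj C (prof_comp_integrand C P (hom_prof C) c e) d (p, f)"
      by (auto elim!: prof_compE simp: Fo_eq Fo_hom_prof Fm_hom_prof)
    have "prof_runit C P (c, e) U = Fm P (c, d) (c, e) (Idn C c, f) p"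
      using ob U unfolding prof_runit_def
      by (simp, subst prof_comp_case_inj[OF C P H])
        (simp_all add: Fo_hom_prof Fm_hom_prof Fo_eq Fm_eq C.idn_in C.cmp_in C.cmp_idn_right C.cmp_idn_left
          unit_in unit_idn unit_cmp K_rules)
    then show "\<mu> (c, e) (prof_hcomp C P (hom_prof C) P P prof_id \<eta> (c, e) U) = prof_runit C P (c, e) U"
      using ob U
      by (simp add: prof_hcomp_inj[OF P H prof_trans_prof_id prof_trans_unit] Fo_hom_prof Fm_hom_prof Fo_eq
        prof_id_apply mult_inj unit_in Fm_eq C.idn_in unit_idn K_rules)
  next
    fix T assume T_in: "T \<in> Fo (prof_comp C (prof_comp C P P) P) (c, e)"
    obtain d' S r where T: "d' \<in> Ob C" "S \<in> Fo (prof_comp C P P) (c, d')" "r \<in> Hom K d' e"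
      "T = coend_inj C (prof_comp_integrand C (prof_comp C P P) P c e) d' (S, r)"
      by (rule prof_compE[OF T_in]) (simp add: Fo_eq)
    then obtain d p q where S: "d \<in> Ob C" "p \<in> Hom K c d" "q \<in> Hom K d d'"
      "S = coend_inj C (prof_comp_integrand C P P c d') d (p, q)"
      by (auto elim!: prof_compE simp: Fo_eq)
    note balanced = prof_comp_inj_balanced[OF C P PP] prof_comp_inj_balanced[OF C P P]
    \<comment> \<open>\<open>\<phi>\<close> is the body of the associator. It nests one coend
      elimination in another, so evaluating it takes two balancing arguments: at the inner middle
      object for fixed \<open>r\<close>, then at the outer one.\<close>
    define \<phi> where "\<phi> = (\<lambda>d2 (T, r). coend_case (\<lambda>d1 (p, q).
         coend_inj C (prof_comp_integrand C P (prof_comp C P P) c e) d1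
           (p, coend_inj C (prof_comp_integrand C P P d1 e) d2 (q, r))) T)"
    have inner: "\<phi> d2 (coend_inj C (prof_comp_integrand C P P c d2) d1 (p, q), r)
      = coend_inj C (prof_comp_integrand C P (prof_comp C P P) c e) d1
           (p, coend_inj C (prof_comp_integrand C P P d1 e) d2 (q, r))"
      if pqr: "d1 \<in> Ob C" "d2 \<in> Ob C" "p \<in> Hom K c d1" "q \<in> Hom K d1 d2" "r \<in> Hom K d2 e" for d1 d2 p q r
      unfolding \<phi>_def prod.case
    proof (subst prof_comp_case_inj[OF C P P], goal_cases)
      \<comment> \<open>To move \<open>u\<close> from the class of \<open>(q, r)\<close> to
        \<open>p\<close>, it is first recognised as acting on the composite profunctor.\<close>
      case (6 d d' u p q)
      have "coend_inj C (prof_comp_integrand C P P d e) d2 (Fm P (d', d2) (d, d2) (u, Idn C d2) q, r)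
        = Fm (prof_comp C P P) (d', e) (d, e) (u, Idn C e) (coend_inj C (prof_comp_integrand C P P d' e) d2 (q, r))"
        using 6 ob pqr by (simp add: prof_comp_Fm_inj[OF C P P] Fo_eq C.idn_in endoprofunctor_idn[OF P])
      then show ?case
        using 6 ob pqr by (simp add: balanced prof_comp_inj_in Fo_eq)
    qed (use ob pqr in \<open>simp_all add: Fo_eq\<close>)
    have "prof_assoc C P P P (c, e) T = \<phi> d' (S, r)"
      unfolding prof_assoc_def prod.case T(4) \<phi>_def[symmetric]
    proof (rule prof_comp_case_inj[OF C PP P ob], goal_cases)
      \<comment> \<open>Here \<open>u\<close> sits between \<open>q\<close> and \<open>r\<close>, so
        the class \<open>S\<close> is opened first and balancing is applied in the inner
        coend.\<close>
      case (4 d d' u S r)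
      obtain d1 p q where S: "d1 \<in> Ob C" "p \<in> Hom K c d1" "q \<in> Hom K d1 d"
        "S = coend_inj C (prof_comp_integrand C P P c d) d1 (p, q)"
        using 4 by (auto elim!: prof_compE simp: Fo_eq)
      have ins: "Fm P (d', e) (d, e) (u, Idn C e) r \<in> Hom K d e" "Fm P (d1, d) (d1, d') (Idn C d1, u) q \<in> Hom K d1 d'"
        using endoprofunctor_in[OF P] 4 ob S unfolding Fo_eq by (simp_all add: C.idn_in)
      then show ?case
        using 4 ob S by (simp add: prof_comp_Fm_inj[OF C P P] inner Fo_eq C.idn_in endoprofunctor_idn[OF P] balanced)
    qed (use ob T in \<open>simp_all add: Fo_eq\<close>)
    then have "prof_assoc C P P P (c, e) T
      = coend_inj C (prof_comp_integrand C P (prof_comp C P P) c e) d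
           (p, coend_inj C (prof_comp_integrand C P P d e) d' (q, r))"
      using T S by (simp add: inner)
    \<comment> \<open>On these representatives the sides are \<open>r \<circ> (q \<circ> p)\<close>
      and \<open>(r \<circ> q) \<circ> p\<close> in \<open>K\<close>.\<close>
    then show "\<mu> (c, e) (prof_hcomp C (prof_comp C P P) P P P \<mu> prof_id (c, e) T) =
           \<mu> (c, e) (prof_hcomp C P (prof_comp C P P) P P prof_id \<mu> (c, e) (prof_assoc C P P P (c, e) T))"
      using ob T S
      by (simp add: prof_hcomp_inj[OF P PP prof_trans_prof_id prof_trans_mult]
        prof_hcomp_inj[OF PP P prof_trans_mult prof_trans_prof_id] prof_comp_inj_in Fo_eq mult_inj prof_id_apply
        K_rules)
  }
qed

lemma Cmp_kleisli:
  assumes "c \<in> Ob C" "d \<in> Ob C" "e \<in> Ob C" "p \<in> Hom K c d" "q \<in> Hom K d e"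
  shows "Cmp (kleisli C P \<eta> \<mu>) c d e q p = Cmp K c d e q p"
  using mult_inj[OF assms] by (simp add: kleisli_def)

lemma category_kleisli: "category (kleisli C P \<eta> \<mu>)"
proof -
  have "Ob (kleisli C P \<eta> \<mu>) = Ob C" "\<And>c d. Hom (kleisli C P \<eta> \<mu>) c d = Hom K c d"
    "\<And>c. c \<in> Ob C \<Longrightarrow> Idn (kleisli C P \<eta> \<mu>) c = Idn K c"
    by (simp_all add: kleisli_def Fo_eq unit_idn)
  then show ?thesis
    by unfold_locales (simp_all add: Cmp_kleisli K_rules)
qed

end

section \<open>Calculating in strict monoidal categories\<close>

text \<open>Composites are normalised by bracketing to the right, where the left side of a commuting
  square is no longer a subterm: its inner factor is already composed with whatever comes before.
  This form rewrites the square in that position.\<close>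

lemma (in category) cmp_square:
  assumes "Cmp C a b d g f = Cmp C a c d k h"
    and "z \<in> Ob C" "a \<in> Ob C" "b \<in> Ob C" "c \<in> Ob C" "d \<in> Ob C"
      "e \<in> Hom C z a" "f \<in> Hom C a b" "g \<in> Hom C b d" "h \<in> Hom C a c" "k \<in> Hom C c d"
  shows "Cmp C z b d g (Cmp C z a b f e) = Cmp C z c d k (Cmp C z a c h e)"
  using assms by (simp add: cmp_assoc)

text \<open>
  Strictness makes \<open>(a \<otimes> b) \<otimes> c\<close> and \<open>a \<otimes> (b \<otimes> c)\<close> equal but syntactically different indices
  of \<^const>\<open>Cmp\<close>. The rules below therefore take the indices as variables constrained by
  equations, so that they still apply after the simplifier has rebracketed the objects.
\<close>

context strict_monoidal
begin

lemma ten_ob_in: "\<lbrakk>a \<in> Ob M; b \<in> Ob M\<rbrakk> \<Longrightarrow> ten_ob M a b \<in> Ob M"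
  using tensor.Fo_in[of "(a, b)"] by (simp add: prod_cat_def)

lemma ten_ar_in:
  assumes "p = ten_ob M a b" "q = ten_ob M a' b'"
    and "a \<in> Ob M" "a' \<in> Ob M" "b \<in> Ob M" "b' \<in> Ob M" "f \<in> Hom M a a'" "g \<in> Hom M b b'"
  shows "ten_ar M a a' b b' f g \<in> Hom M p q"
  using tensor.Fm_in[of "(a, b)" "(a', b')" "(f, g)"] assms by (simp add: prod_cat_def)

lemma ten_ar_idn:
  "\<lbrakk>a \<in> Ob M; b \<in> Ob M\<rbrakk> \<Longrightarrow> ten_ar M a a b b (Idn M a) (Idn M b) = Idn M (ten_ob M a b)"
  using tensor.Fm_idn[of "(a, b)"] by (simp add: prod_cat_def)

lemma ten_ar_cmp:
  assumes "p = ten_ob M a b" "q = ten_ob M a' b'" "r = ten_ob M a'' b''"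
    and "a \<in> Ob M" "a' \<in> Ob M" "a'' \<in> Ob M" "b \<in> Ob M" "b' \<in> Ob M" "b'' \<in> Ob M"
    and "f \<in> Hom M a a'" "f' \<in> Hom M a' a''" "g \<in> Hom M b b'" "g' \<in> Hom M b' b''"
  shows "Cmp M p q r (ten_ar M a' a'' b' b'' f' g') (ten_ar M a a' b b' f g)
    = ten_ar M a a'' b b'' (Cmp M a a' a'' f' f) (Cmp M b b' b'' g' g)"
  using tensor.Fm_cmp[of "(a, b)" "(a', b')" "(a'', b'')" "(f, g)" "(f', g')"] assms
  by (simp add: prod_cat_def)

lemmas hom_rules = ten_ob_in ten_ar_in idn_in cmp_in unt_in
lemmas idn_rules = cmp_idn_left cmp_idn_right
lemmas ob_rules = ten_ob_assoc ten_ob_unt_left ten_ob_unt_right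

text \<open>This and its mirror image rewrite against the direction of \<open>ten_ar_cmp\<close>:
  whiskered composites are broken up so that squares inside them become visible.\<close>

lemma ten_ar_cmp_left:
  assumes "a \<in> Ob M" "b \<in> Ob M" "b' \<in> Ob M" "b'' \<in> Ob M" "g \<in> Hom M b b'" "g' \<in> Hom M b' b''"
  shows "ten_ar M a a b b'' (Idn M a) (Cmp M b b' b'' g' g)
    = Cmp M (ten_ob M a b) (ten_ob M a b') (ten_ob M a b'')
        (ten_ar M a a b' b'' (Idn M a) g') (ten_ar M a a b b' (Idn M a) g)"
  using assms by (simp add: ten_ar_cmp idn_rules idn_in)

lemma ten_ar_cmp_right:
  assumes "b \<in> Ob M" "a \<in> Ob M" "a' \<in> Ob M" "a'' \<in> Ob M" "f \<in> Hom M a a'" "f' \<in> Hom M a' a''"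
  shows "ten_ar M a a'' b b (Cmp M a a' a'' f' f) (Idn M b)
    = Cmp M (ten_ob M a b) (ten_ob M a' b) (ten_ob M a'' b)
        (ten_ar M a' a'' b b f' (Idn M b)) (ten_ar M a a' b b f (Idn M b))"
  using assms by (simp add: ten_ar_cmp idn_rules idn_in)

text \<open>Both orders of acting equal \<open>f \<otimes> g\<close>. The commutations below between
  an argument of a composition and \<open>\<psi>0\<close>, \<open>\<psi>2\<close> or a coend arrow
  \<open>u\<close> are instances.\<close>

lemma exchange:
  assumes "p = ten_ob M a b" "q = ten_ob M a b'" "r = ten_ob M a' b'"
    and "a \<in> Ob M" "a' \<in> Ob M" "b \<in> Ob M" "b' \<in> Ob M" "f \<in> Hom M a a'" "g \<in> Hom M b b'"
  shows "Cmp M p q r (ten_ar M a a' b' b' f (Idn M b')) (ten_ar M a a b b' (Idn M a) g)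
    = Cmp M p (ten_ob M a' b) r (ten_ar M a' a' b b' (Idn M a') g) (ten_ar M a a' b b f (Idn M b))"
  using assms by (simp add: ten_ar_cmp idn_rules idn_in)

lemma ten_ar_assoc':
  assumes "p = ten_ob M a b" "q = ten_ob M a' b'"
    and "a \<in> Ob M" "a' \<in> Ob M" "b \<in> Ob M" "b' \<in> Ob M" "c \<in> Ob M" "c' \<in> Ob M"
    and "f \<in> Hom M a a'" "g \<in> Hom M b b'" "h \<in> Hom M c c'"
  shows "ten_ar M p q c c' (ten_ar M a a' b b' f g) h
        = ten_ar M a a' (ten_ob M b c) (ten_ob M b' c') f (ten_ar M b b' c c' g h)"
  using assms by (simp add: ten_ar_assoc)

lemma ten_ar_idn_assoc:
  assumes "a \<in> Ob M" "b \<in> Ob M" "c \<in> Ob M" "c' \<in> Ob M" "g \<in> Hom M c c'"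
  shows "ten_ar M (ten_ob M a b) (ten_ob M a b) c c' (Idn M (ten_ob M a b)) g
    = ten_ar M a a (ten_ob M b c) (ten_ob M b c') (Idn M a) (ten_ar M b b c c' (Idn M b) g)"
  using assms ten_ar_assoc[of a a b b c c' "Idn M a" "Idn M b" g] by (simp add: ten_ar_idn idn_in)

end

section \<open>The Kleisli composition on \<open>A \<times> X\<close>\<close>

context lax_monoidal_functor
begin

abbreviation ob_A (infixr "\<otimes>\<^sub>A" 70) where "a \<otimes>\<^sub>A b \<equiv> ten_ob A a b"
abbreviation ob_X (infixr "\<otimes>\<^sub>X" 70) where "x \<otimes>\<^sub>X y \<equiv> ten_ob X x y"
abbreviation F_ob ("\<F>") where "\<F> m \<equiv> Fo F m"

lemmas rules = X.hom_rules A.hom_rules Fo_in Fm_in X.ob_rules A.ob_rules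

lemma psi2_in:
  assumes "p = \<F> m \<otimes>\<^sub>A \<F> n" "q = \<F> (m \<otimes>\<^sub>X n)" "m \<in> Ob X" "n \<in> Ob X"
  shows "\<psi>2 (m, n) \<in> Hom A p q"
  using mult.component_in[of "(m, n)"] assms by (simp add: prod_cat_def func_comp_def func_prod_def)

lemma psi2_natural:
  assumes "m \<in> Ob X" "m' \<in> Ob X" "n \<in> Ob X" "n' \<in> Ob X" "u \<in> Hom X m m'" "v \<in> Hom X n n'"
  shows "Cmp A (\<F> m \<otimes>\<^sub>A \<F> n) (\<F> m' \<otimes>\<^sub>A \<F> n') (\<F> (m' \<otimes>\<^sub>X n')) (\<psi>2 (m', n'))
      (ten_ar A (\<F> m) (\<F> m') (\<F> n) (\<F> n') (Fm F m m' u) (Fm F n n' v))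
    = Cmp A (\<F> m \<otimes>\<^sub>A \<F> n) (\<F> (m \<otimes>\<^sub>X n)) (\<F> (m' \<otimes>\<^sub>X n'))
      (Fm F (m \<otimes>\<^sub>X n) (m' \<otimes>\<^sub>X n') (ten_ar X m m' n n' u v)) (\<psi>2 (m, n))"
  using mult.natural[of "(m, n)" "(m', n')" "(u, v)"] assms
  by (simp add: prod_cat_def func_comp_def func_prod_def)

section \<open>Composition of representatives, separately in A and in X\<close>

definition comp_A where
  "comp_A a b c m n s' s = Cmp A a (b \<otimes>\<^sub>A \<F> m) (c \<otimes>\<^sub>A \<F> (n \<otimes>\<^sub>X m))
     (Cmp A (b \<otimes>\<^sub>A \<F> m) (c \<otimes>\<^sub>A \<F> n \<otimes>\<^sub>A \<F> m) (c \<otimes>\<^sub>A \<F> (n \<otimes>\<^sub>X m))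
        (ten_ar A c c (\<F> n \<otimes>\<^sub>A \<F> m) (\<F> (n \<otimes>\<^sub>X m)) (Idn A c) (\<psi>2 (n, m)))
        (ten_ar A b (c \<otimes>\<^sub>A \<F> n) (\<F> m) (\<F> m) s' (Idn A (\<F> m)))) s"

definition comp_X where
  "comp_X x y z m n t' t = Cmp X (n \<otimes>\<^sub>X m \<otimes>\<^sub>X x) (n \<otimes>\<^sub>X y) z t' (ten_ar X n n (m \<otimes>\<^sub>X x) y (Idn X n) t)"

lemma comp_A_in:
  assumes "a \<in> Ob A" "b \<in> Ob A" "c \<in> Ob A" "m \<in> Ob X" "n \<in> Ob X"
    "s \<in> Hom A a (b \<otimes>\<^sub>A \<F> m)" "s' \<in> Hom A b (c \<otimes>\<^sub>A \<F> n)"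
  shows "comp_A a b c m n s' s \<in> Hom A a (c \<otimes>\<^sub>A \<F> (n \<otimes>\<^sub>X m))"
  using assms by (simp add: comp_A_def rules psi2_in)

lemma comp_X_in:
  assumes "x \<in> Ob X" "y \<in> Ob X" "z \<in> Ob X" "m \<in> Ob X" "n \<in> Ob X"
    "t \<in> Hom X (m \<otimes>\<^sub>X x) y" "t' \<in> Hom X (n \<otimes>\<^sub>X y) z"
  shows "comp_X x y z m n t' t \<in> Hom X ((n \<otimes>\<^sub>X m) \<otimes>\<^sub>X x) z"
  using assms by (simp add: comp_X_def rules)

text \<open>The four shift lemmas make composition well defined on classes: sliding \<open>u\<close>
  in one factor amounts to sliding \<open>u\<close>, tensored with an identity, in the product. Here
  \<open>u\<close> and \<open>t\<close> act on different tensor factors and are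
  interchanged.\<close>

lemma comp_X_shift_left:
  assumes "x \<in> Ob X" "y \<in> Ob X" "z \<in> Ob X" "m \<in> Ob X" "n \<in> Ob X" "n' \<in> Ob X"
    "t \<in> Hom X (m \<otimes>\<^sub>X x) y" "t' \<in> Hom X (n' \<otimes>\<^sub>X y) z" "u \<in> Hom X n n'"
  shows "comp_X x y z m n (Cmp X (n \<otimes>\<^sub>X y) (n' \<otimes>\<^sub>X y) z t' (ten_ar X n n' y y u (Idn X y))) t
    = Cmp X ((n \<otimes>\<^sub>X m) \<otimes>\<^sub>X x) ((n' \<otimes>\<^sub>X m) \<otimes>\<^sub>X x) z (comp_X x y z m n' t' t)
        (ten_ar X (n \<otimes>\<^sub>X m) (n' \<otimes>\<^sub>X m) x x (ten_ar X n n' m m u (Idn X m)) (Idn X x))"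
  using assms
  by (simp add: comp_X_def rules X.cmp_assoc[symmetric] X.ten_ar_assoc' X.ten_ar_idn X.exchange)

lemma comp_X_shift_right:
  assumes "x \<in> Ob X" "y \<in> Ob X" "z \<in> Ob X" "m \<in> Ob X" "m' \<in> Ob X" "n \<in> Ob X"
    "t \<in> Hom X (m' \<otimes>\<^sub>X x) y" "t' \<in> Hom X (n \<otimes>\<^sub>X y) z" "u \<in> Hom X m m'"
  shows "comp_X x y z m n t' (Cmp X (m \<otimes>\<^sub>X x) (m' \<otimes>\<^sub>X x) y t (ten_ar X m m' x x u (Idn X x)))
    = Cmp X ((n \<otimes>\<^sub>X m) \<otimes>\<^sub>X x) ((n \<otimes>\<^sub>X m') \<otimes>\<^sub>X x) z (comp_X x y z m' n t' t)
        (ten_ar X (n \<otimes>\<^sub>X m) (n \<otimes>\<^sub>X m') x x (ten_ar X n n m m' (Idn X n) u) (Idn X x))"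
  using assms
  by (simp add: comp_X_def rules X.cmp_assoc[symmetric] X.ten_ar_assoc' X.ten_ar_cmp_left)

lemma comp_X_assoc:
  assumes "x \<in> Ob X" "y \<in> Ob X" "z \<in> Ob X" "w \<in> Ob X" "m \<in> Ob X" "n \<in> Ob X" "k \<in> Ob X"
    "t \<in> Hom X (m \<otimes>\<^sub>X x) y" "t' \<in> Hom X (n \<otimes>\<^sub>X y) z" "t'' \<in> Hom X (k \<otimes>\<^sub>X z) w"
  shows "comp_X x z w (n \<otimes>\<^sub>X m) k t'' (comp_X x y z m n t' t)
    = comp_X x y w m (k \<otimes>\<^sub>X n) (comp_X y z w n k t'' t') t"
  using assms
  by (simp add: comp_X_def rules X.cmp_assoc[symmetric] X.ten_ar_idn_assoc X.ten_ar_cmp_left)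

lemma comp_A_shift_left:
  assumes "a \<in> Ob A" "b \<in> Ob A" "c \<in> Ob A" "m \<in> Ob X" "n \<in> Ob X" "n' \<in> Ob X"
    "s \<in> Hom A a (b \<otimes>\<^sub>A \<F> m)" "s' \<in> Hom A b (c \<otimes>\<^sub>A \<F> n)" "u \<in> Hom X n n'"
  shows "comp_A a b c m n' (Cmp A b (c \<otimes>\<^sub>A \<F> n) (c \<otimes>\<^sub>A \<F> n')
        (ten_ar A c c (\<F> n) (\<F> n') (Idn A c) (Fm F n n' u)) s') s
    = Cmp A a (c \<otimes>\<^sub>A \<F> (n \<otimes>\<^sub>X m)) (c \<otimes>\<^sub>A \<F> (n' \<otimes>\<^sub>X m))
        (ten_ar A c c (\<F> (n \<otimes>\<^sub>X m)) (\<F> (n' \<otimes>\<^sub>X m)) (Idn A c)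
          (Fm F (n \<otimes>\<^sub>X m) (n' \<otimes>\<^sub>X m) (ten_ar X n n' m m u (Idn X m))))
        (comp_A a b c m n s' s)"
proof -
  \<comment> \<open>Naturality of \<open>\<psi>2\<close> in its first argument, tensored with
    \<open>c\<close> on the left.\<close>
  have "Cmp A (c \<otimes>\<^sub>A \<F> n \<otimes>\<^sub>A \<F> m) (c \<otimes>\<^sub>A \<F> n' \<otimes>\<^sub>A \<F> m) (c \<otimes>\<^sub>A \<F> (n' \<otimes>\<^sub>X m))
      (ten_ar A c c (\<F> n' \<otimes>\<^sub>A \<F> m) (\<F> (n' \<otimes>\<^sub>X m)) (Idn A c) (\<psi>2 (n', m)))
      (ten_ar A c c (\<F> n \<otimes>\<^sub>A \<F> m) (\<F> n' \<otimes>\<^sub>A \<F> m) (Idn A c)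
        (ten_ar A (\<F> n) (\<F> n') (\<F> m) (\<F> m) (Fm F n n' u) (Idn A (\<F> m))))
    = Cmp A (c \<otimes>\<^sub>A \<F> n \<otimes>\<^sub>A \<F> m) (c \<otimes>\<^sub>A \<F> (n \<otimes>\<^sub>X m)) (c \<otimes>\<^sub>A \<F> (n' \<otimes>\<^sub>X m))
        (ten_ar A c c (\<F> (n \<otimes>\<^sub>X m)) (\<F> (n' \<otimes>\<^sub>X m)) (Idn A c)
          (Fm F (n \<otimes>\<^sub>X m) (n' \<otimes>\<^sub>X m) (ten_ar X n n' m m u (Idn X m))))
        (ten_ar A c c (\<F> n \<otimes>\<^sub>A \<F> m) (\<F> (n \<otimes>\<^sub>X m)) (Idn A c) (\<psi>2 (n, m)))"
    using assms psi2_natural[of n n' m m u "Idn X m"]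
    by (simp add: rules psi2_in A.ten_ar_cmp A.idn_rules Fm_idn)
  note square = A.cmp_square[OF this]
  show ?thesis
    using assms
    by (simp add: comp_A_def rules psi2_in A.cmp_assoc[symmetric] A.ten_ar_cmp_right A.ten_ar_assoc' square)
qed

lemma comp_A_shift_right:
  assumes "a \<in> Ob A" "b \<in> Ob A" "c \<in> Ob A" "m \<in> Ob X" "m' \<in> Ob X" "n \<in> Ob X"
    "s \<in> Hom A a (b \<otimes>\<^sub>A \<F> m)" "s' \<in> Hom A b (c \<otimes>\<^sub>A \<F> n)" "u \<in> Hom X m m'"
  shows "comp_A a b c m' n s' (Cmp A a (b \<otimes>\<^sub>A \<F> m) (b \<otimes>\<^sub>A \<F> m')
        (ten_ar A b b (\<F> m) (\<F> m') (Idn A b) (Fm F m m' u)) s)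
    = Cmp A a (c \<otimes>\<^sub>A \<F> (n \<otimes>\<^sub>X m)) (c \<otimes>\<^sub>A \<F> (n \<otimes>\<^sub>X m'))
        (ten_ar A c c (\<F> (n \<otimes>\<^sub>X m)) (\<F> (n \<otimes>\<^sub>X m')) (Idn A c)
          (Fm F (n \<otimes>\<^sub>X m) (n \<otimes>\<^sub>X m') (ten_ar X n n m m' (Idn X n) u)))
        (comp_A a b c m n s' s)"
proof -
  \<comment> \<open>Interchange lets the image of \<open>u\<close> under F pass \<open>s'\<close>;
    the second square is naturality of \<open>\<psi>2\<close> in its second argument, tensored with
    \<open>c\<close>.\<close>
  have 1: "Cmp A (b \<otimes>\<^sub>A \<F> m) (b \<otimes>\<^sub>A \<F> m') (c \<otimes>\<^sub>A \<F> n \<otimes>\<^sub>A \<F> m')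
      (ten_ar A b (c \<otimes>\<^sub>A \<F> n) (\<F> m') (\<F> m') s' (Idn A (\<F> m')))
      (ten_ar A b b (\<F> m) (\<F> m') (Idn A b) (Fm F m m' u))
    = Cmp A (b \<otimes>\<^sub>A \<F> m) (c \<otimes>\<^sub>A \<F> n \<otimes>\<^sub>A \<F> m) (c \<otimes>\<^sub>A \<F> n \<otimes>\<^sub>A \<F> m')
      (ten_ar A c c (\<F> n \<otimes>\<^sub>A \<F> m) (\<F> n \<otimes>\<^sub>A \<F> m') (Idn A c)
        (ten_ar A (\<F> n) (\<F> n) (\<F> m) (\<F> m') (Idn A (\<F> n)) (Fm F m m' u)))
      (ten_ar A b (c \<otimes>\<^sub>A \<F> n) (\<F> m) (\<F> m) s' (Idn A (\<F> m)))"
    using assms A.exchange[of _ b "\<F> m" _ "\<F> m'" _ "c \<otimes>\<^sub>A \<F> n" s' "Fm F m m' u"]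
    by (simp add: rules A.ten_ar_idn_assoc)
  have 2: "Cmp A (c \<otimes>\<^sub>A \<F> n \<otimes>\<^sub>A \<F> m) (c \<otimes>\<^sub>A \<F> n \<otimes>\<^sub>A \<F> m') (c \<otimes>\<^sub>A \<F> (n \<otimes>\<^sub>X m'))
      (ten_ar A c c (\<F> n \<otimes>\<^sub>A \<F> m') (\<F> (n \<otimes>\<^sub>X m')) (Idn A c) (\<psi>2 (n, m')))
      (ten_ar A c c (\<F> n \<otimes>\<^sub>A \<F> m) (\<F> n \<otimes>\<^sub>A \<F> m') (Idn A c)
        (ten_ar A (\<F> n) (\<F> n) (\<F> m) (\<F> m') (Idn A (\<F> n)) (Fm F m m' u)))
    = Cmp A (c \<otimes>\<^sub>A \<F> n \<otimes>\<^sub>A \<F> m) (c \<otimes>\<^sub>A \<F> (n \<otimes>\<^sub>X m)) (c \<otimes>\<^sub>A \<F> (n \<otimes>\<^sub>X m'))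
        (ten_ar A c c (\<F> (n \<otimes>\<^sub>X m)) (\<F> (n \<otimes>\<^sub>X m')) (Idn A c)
          (Fm F (n \<otimes>\<^sub>X m) (n \<otimes>\<^sub>X m') (ten_ar X n n m m' (Idn X n) u)))
        (ten_ar A c c (\<F> n \<otimes>\<^sub>A \<F> m) (\<F> (n \<otimes>\<^sub>X m)) (Idn A c) (\<psi>2 (n, m)))"
    using assms psi2_natural[of n n m m' "Idn X n" u]
    by (simp add: rules psi2_in A.ten_ar_cmp A.idn_rules Fm_idn)
  show ?thesis
    using assms
    by (simp add: comp_A_def rules psi2_in A.cmp_assoc[symmetric] A.cmp_square[OF 1] A.cmp_square[OF 2])
qed

text \<open>On the left \<open>s''\<close> acts after the first \<open>\<psi>2\<close>. Interchange
  moves it in front; then on both sides all arguments precede all structure maps, and these agree by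
  associativity of \<open>\<psi>2\<close>. The targets coincide because X is strict.\<close>

lemma comp_A_assoc:
  assumes "a \<in> Ob A" "b \<in> Ob A" "c \<in> Ob A" "d \<in> Ob A" "m \<in> Ob X" "n \<in> Ob X" "k \<in> Ob X"
    "s \<in> Hom A a (b \<otimes>\<^sub>A \<F> m)" "s' \<in> Hom A b (c \<otimes>\<^sub>A \<F> n)" "s'' \<in> Hom A c (d \<otimes>\<^sub>A \<F> k)"
  shows "comp_A a c d (n \<otimes>\<^sub>X m) k s'' (comp_A a b c m n s' s)
    = comp_A a b d m (k \<otimes>\<^sub>X n) (comp_A b c d n k s'' s') s"
proof -
  have 1: "Cmp A (c \<otimes>\<^sub>A \<F> n \<otimes>\<^sub>A \<F> m) (c \<otimes>\<^sub>A \<F> (n \<otimes>\<^sub>X m)) (d \<otimes>\<^sub>A \<F> k \<otimes>\<^sub>A \<F> (n \<otimes>\<^sub>X m))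
      (ten_ar A c (d \<otimes>\<^sub>A \<F> k) (\<F> (n \<otimes>\<^sub>X m)) (\<F> (n \<otimes>\<^sub>X m)) s'' (Idn A (\<F> (n \<otimes>\<^sub>X m))))
      (ten_ar A c c (\<F> n \<otimes>\<^sub>A \<F> m) (\<F> (n \<otimes>\<^sub>X m)) (Idn A c) (\<psi>2 (n, m)))
    = Cmp A (c \<otimes>\<^sub>A \<F> n \<otimes>\<^sub>A \<F> m) (d \<otimes>\<^sub>A \<F> k \<otimes>\<^sub>A \<F> n \<otimes>\<^sub>A \<F> m) (d \<otimes>\<^sub>A \<F> k \<otimes>\<^sub>A \<F> (n \<otimes>\<^sub>X m))
      (ten_ar A d d (\<F> k \<otimes>\<^sub>A \<F> n \<otimes>\<^sub>A \<F> m) (\<F> k \<otimes>\<^sub>A \<F> (n \<otimes>\<^sub>X m)) (Idn A d)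
        (ten_ar A (\<F> k) (\<F> k) (\<F> n \<otimes>\<^sub>A \<F> m) (\<F> (n \<otimes>\<^sub>X m)) (Idn A (\<F> k)) (\<psi>2 (n, m))))
      (ten_ar A c (d \<otimes>\<^sub>A \<F> k) (\<F> n \<otimes>\<^sub>A \<F> m) (\<F> n \<otimes>\<^sub>A \<F> m) s'' (Idn A (\<F> n \<otimes>\<^sub>A \<F> m)))"
    using assms A.exchange[of _ c "\<F> n \<otimes>\<^sub>A \<F> m" _ "\<F> (n \<otimes>\<^sub>X m)" _ "d \<otimes>\<^sub>A \<F> k" s'' "\<psi>2 (n, m)"]
    by (simp add: rules psi2_in A.ten_ar_idn_assoc)
  have 2: "Cmp A (d \<otimes>\<^sub>A \<F> k \<otimes>\<^sub>A \<F> n \<otimes>\<^sub>A \<F> m) (d \<otimes>\<^sub>A \<F> (k \<otimes>\<^sub>X n) \<otimes>\<^sub>A \<F> m) (d \<otimes>\<^sub>A \<F> (k \<otimes>\<^sub>X n \<otimes>\<^sub>X m))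
      (ten_ar A d d (\<F> (k \<otimes>\<^sub>X n) \<otimes>\<^sub>A \<F> m) (\<F> (k \<otimes>\<^sub>X n \<otimes>\<^sub>X m)) (Idn A d) (\<psi>2 (k \<otimes>\<^sub>X n, m)))
      (ten_ar A d d (\<F> k \<otimes>\<^sub>A \<F> n \<otimes>\<^sub>A \<F> m) (\<F> (k \<otimes>\<^sub>X n) \<otimes>\<^sub>A \<F> m) (Idn A d)
        (ten_ar A (\<F> k \<otimes>\<^sub>A \<F> n) (\<F> (k \<otimes>\<^sub>X n)) (\<F> m) (\<F> m) (\<psi>2 (k, n)) (Idn A (\<F> m))))
    = Cmp A (d \<otimes>\<^sub>A \<F> k \<otimes>\<^sub>A \<F> n \<otimes>\<^sub>A \<F> m) (d \<otimes>\<^sub>A \<F> k \<otimes>\<^sub>A \<F> (n \<otimes>\<^sub>X m)) (d \<otimes>\<^sub>A \<F> (k \<otimes>\<^sub>X n \<otimes>\<^sub>X m))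
      (ten_ar A d d (\<F> k \<otimes>\<^sub>A \<F> (n \<otimes>\<^sub>X m)) (\<F> (k \<otimes>\<^sub>X n \<otimes>\<^sub>X m)) (Idn A d) (\<psi>2 (k, n \<otimes>\<^sub>X m)))
      (ten_ar A d d (\<F> k \<otimes>\<^sub>A \<F> n \<otimes>\<^sub>A \<F> m) (\<F> k \<otimes>\<^sub>A \<F> (n \<otimes>\<^sub>X m)) (Idn A d)
        (ten_ar A (\<F> k) (\<F> k) (\<F> n \<otimes>\<^sub>A \<F> m) (\<F> (n \<otimes>\<^sub>X m)) (Idn A (\<F> k)) (\<psi>2 (n, m))))"
    using assms psi2_assoc[of k n m]
    by (simp add: rules psi2_in A.ten_ar_cmp A.idn_rules)
  show ?thesis
    using assms
    by (simp add: comp_A_def rules psi2_in A.cmp_assoc[symmetric] A.cmp_square[OF 1] A.cmp_square[OF 2]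
      A.ten_ar_cmp_right A.ten_ar_assoc' A.ten_ar_idn)
qed

text \<open>Stated for the image of any arrow \<open>h\<close>, not only of an identity: the same
  computation then serves the unit law, functoriality of the unit and the action of
  \<open>A \<times> X\<close> on the profunctor.\<close>

lemma comp_A_unit_left:
  assumes "a \<in> Ob A" "b \<in> Ob A" "c \<in> Ob A" "m \<in> Ob X" "s \<in> Hom A a (b \<otimes>\<^sub>A \<F> m)" "h \<in> Hom A b c"
  shows "comp_A a b c m (Unt X) (Cmp A b c (c \<otimes>\<^sub>A \<F> (Unt X))
        (ten_ar A c c (Unt A) (\<F> (Unt X)) (Idn A c) \<psi>0) h) s
    = Cmp A a (b \<otimes>\<^sub>A \<F> m) (c \<otimes>\<^sub>A \<F> m) (ten_ar A b c (\<F> m) (\<F> m) h (Idn A (\<F> m))) s"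
proof -
  \<comment> \<open>Left unit coherence of F, tensored with \<open>c\<close>. The right side is a
    composite of two identities to have the shape that \<open>cmp_square\<close> expects.\<close>
  have 1: "Cmp A (c \<otimes>\<^sub>A \<F> m) (c \<otimes>\<^sub>A \<F> (Unt X) \<otimes>\<^sub>A \<F> m) (c \<otimes>\<^sub>A \<F> m)
      (ten_ar A c c (\<F> (Unt X) \<otimes>\<^sub>A \<F> m) (\<F> m) (Idn A c) (\<psi>2 (Unt X, m)))
      (ten_ar A c c (\<F> m) (\<F> (Unt X) \<otimes>\<^sub>A \<F> m) (Idn A c)
        (ten_ar A (Unt A) (\<F> (Unt X)) (\<F> m) (\<F> m) \<psi>0 (Idn A (\<F> m))))
    = Cmp A (c \<otimes>\<^sub>A \<F> m) (c \<otimes>\<^sub>A \<F> m) (c \<otimes>\<^sub>A \<F> m) (Idn A (c \<otimes>\<^sub>A \<F> m)) (Idn A (c \<otimes>\<^sub>A \<F> m))"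
    using assms psi_unit_left[of m]
    by (simp add: rules psi2_in psi0_in A.ten_ar_cmp A.idn_rules A.ten_ar_idn)
  show ?thesis
    using assms
    by (simp add: comp_A_def rules psi2_in psi0_in A.cmp_assoc[symmetric] A.cmp_square[OF 1]
      A.ten_ar_cmp_right A.ten_ar_assoc' A.idn_rules)
qed

lemma comp_A_unit_right:
  assumes "a \<in> Ob A" "b \<in> Ob A" "c \<in> Ob A" "m \<in> Ob X" "s \<in> Hom A b (c \<otimes>\<^sub>A \<F> m)" "f \<in> Hom A a b"
  shows "comp_A a b c (Unt X) m s (Cmp A a b (b \<otimes>\<^sub>A \<F> (Unt X))
        (ten_ar A b b (Unt A) (\<F> (Unt X)) (Idn A b) \<psi>0) f)
    = Cmp A a b (c \<otimes>\<^sub>A \<F> m) s f"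
proof -
  \<comment> \<open>The object \<open>b\<close> is read as \<open>b \<otimes> Unt A\<close>, so that
    \<open>s\<close> and \<open>\<psi>0\<close> act on different factors and can be
    interchanged.\<close>
  have 1: "Cmp A b (b \<otimes>\<^sub>A \<F> (Unt X)) (c \<otimes>\<^sub>A \<F> m \<otimes>\<^sub>A \<F> (Unt X))
      (ten_ar A b (c \<otimes>\<^sub>A \<F> m) (\<F> (Unt X)) (\<F> (Unt X)) s (Idn A (\<F> (Unt X))))
      (ten_ar A b b (Unt A) (\<F> (Unt X)) (Idn A b) \<psi>0)
    = Cmp A b (c \<otimes>\<^sub>A \<F> m) (c \<otimes>\<^sub>A \<F> m \<otimes>\<^sub>A \<F> (Unt X))
      (ten_ar A c c (\<F> m) (\<F> m \<otimes>\<^sub>A \<F> (Unt X)) (Idn A c)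
        (ten_ar A (\<F> m) (\<F> m) (Unt A) (\<F> (Unt X)) (Idn A (\<F> m)) \<psi>0)) s"
    using assms A.exchange[of _ b "Unt A" _ "\<F> (Unt X)" _ "c \<otimes>\<^sub>A \<F> m" s \<psi>0]
    by (simp add: rules psi0_in A.ten_ar_idn_assoc A.ten_ar_unt_right)
  have 2: "Cmp A (c \<otimes>\<^sub>A \<F> m) (c \<otimes>\<^sub>A \<F> m \<otimes>\<^sub>A \<F> (Unt X)) (c \<otimes>\<^sub>A \<F> m)
      (ten_ar A c c (\<F> m \<otimes>\<^sub>A \<F> (Unt X)) (\<F> m) (Idn A c) (\<psi>2 (m, Unt X)))
      (ten_ar A c c (\<F> m) (\<F> m \<otimes>\<^sub>A \<F> (Unt X)) (Idn A c)
        (ten_ar A (\<F> m) (\<F> m) (Unt A) (\<F> (Unt X)) (Idn A (\<F> m)) \<psi>0))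
    = Cmp A (c \<otimes>\<^sub>A \<F> m) (c \<otimes>\<^sub>A \<F> m) (c \<otimes>\<^sub>A \<F> m) (Idn A (c \<otimes>\<^sub>A \<F> m)) (Idn A (c \<otimes>\<^sub>A \<F> m))"
    using assms psi_unit_right[of m]
    by (simp add: rules psi2_in psi0_in A.ten_ar_cmp A.idn_rules A.ten_ar_idn)
  show ?thesis
    using assms
    by (simp add: comp_A_def rules psi2_in psi0_in A.cmp_assoc[symmetric] A.cmp_square[OF 1]
      A.cmp_square[OF 2] A.idn_rules)
qed

lemma comp_X_unit_left:
  assumes "x \<in> Ob X" "y \<in> Ob X" "z \<in> Ob X" "m \<in> Ob X" "t \<in> Hom X (m \<otimes>\<^sub>X x) y" "k \<in> Hom X y z"
  shows "comp_X x y z m (Unt X) k t = Cmp X (m \<otimes>\<^sub>X x) y z k t"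
  using assms by (simp add: comp_X_def rules X.ten_ar_unt_left)

lemma comp_X_unit_right:
  assumes "x \<in> Ob X" "y \<in> Ob X" "z \<in> Ob X" "m \<in> Ob X" "g \<in> Hom X x y"
  shows "comp_X x y z (Unt X) m t g = Cmp X (m \<otimes>\<^sub>X x) (m \<otimes>\<^sub>X y) z t (ten_ar X m m x y (Idn X m) g)"
  using assms by (simp add: comp_X_def rules)

section \<open>The promonad on \<open>A \<times> X\<close> and its Kleisli category\<close>

abbreviation cls where
  "cls c d \<equiv> coend_inj X (rtimes_integrand A X F c d)"

lemma Fo_rtimes_integrand:
  "Fo (rtimes_integrand A X F (a, x) (b, y)) (m', m) = Hom A a (b \<otimes>\<^sub>A \<F> m) \<times> Hom X (m' \<otimes>\<^sub>X x) y"
  by (simp add: rtimes_integrand_def)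

lemma Fo_rtimes: "Fo (rtimes A X F) (c, d) = coend X (rtimes_integrand A X F c d)"
  by (simp add: rtimes_def)

lemma rtimes_class_in:
  "\<lbrakk>m \<in> Ob X; s \<in> Hom A a (b \<otimes>\<^sub>A \<F> m); t \<in> Hom X (m \<otimes>\<^sub>X x) y\<rbrakk>
   \<Longrightarrow> cls (a, x) (b, y) m (s, t) \<in> Fo (rtimes A X F) ((a, x), (b, y))"
  by (simp add: Fo_rtimes coend_inj_in Fo_rtimes_integrand)

lemma rtimes_classE:
  assumes "p \<in> Fo (rtimes A X F) ((a, x), (b, y))"
  obtains m s t where "m \<in> Ob X" "s \<in> Hom A a (b \<otimes>\<^sub>A \<F> m)" "t \<in> Hom X (m \<otimes>\<^sub>X x) y"
    "p = cls (a, x) (b, y) m (s, t)"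
  using assms by (auto simp: Fo_rtimes Fo_rtimes_integrand elim!: coendE)

lemma dinatural_rtimes_integrand:
  assumes "a \<in> Ob A" "x \<in> Ob X" "b \<in> Ob A" "y \<in> Ob X"
  shows "dinatural X (rtimes_integrand A X F (a, x) (b, y)) \<phi> \<longleftrightarrow>
    (\<forall>m \<in> Ob X. \<forall>n \<in> Ob X. \<forall>u \<in> Hom X m n. \<forall>s \<in> Hom A a (b \<otimes>\<^sub>A \<F> m). \<forall>t \<in> Hom X (n \<otimes>\<^sub>X x) y.
       \<phi> m (s, Cmp X (m \<otimes>\<^sub>X x) (n \<otimes>\<^sub>X x) y t (ten_ar X m n x x u (Idn X x)))
       = \<phi> n (Cmp A a (b \<otimes>\<^sub>A \<F> m) (b \<otimes>\<^sub>A \<F> n)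
                (ten_ar A b b (\<F> m) (\<F> n) (Idn A b) (Fm F m n u)) s, t))"
  unfolding dinatural_def rtimes_integrand_def using assms
  by (simp add: rules Fm_idn A.ten_ar_idn X.ten_ar_idn A.idn_rules X.idn_rules)

lemma rtimes_class_balanced:
  assumes "a \<in> Ob A" "x \<in> Ob X" "b \<in> Ob A" "y \<in> Ob X" "m \<in> Ob X" "n \<in> Ob X" "u \<in> Hom X m n"
    "s \<in> Hom A a (b \<otimes>\<^sub>A \<F> m)" "t \<in> Hom X (n \<otimes>\<^sub>X x) y"
  shows "cls (a, x) (b, y) m (s, Cmp X (m \<otimes>\<^sub>X x) (n \<otimes>\<^sub>X x) y t (ten_ar X m n x x u (Idn X x)))
    = cls (a, x) (b, y) n (Cmp A a (b \<otimes>\<^sub>A \<F> m) (b \<otimes>\<^sub>A \<F> n)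
                (ten_ar A b b (\<F> m) (\<F> n) (Idn A b) (Fm F m n u)) s, t)"
proof -
  have "dinatural X (rtimes_integrand A X F (a, x) (b, y)) (cls (a, x) (b, y))"
    by (rule dinatural_coend_inj)
      (use assms(1-4) in \<open>auto simp: rtimes_integrand_def rules Fm_idn\<close>)
  then show ?thesis
    using assms by (simp add: dinatural_rtimes_integrand)
qed

lemma rtimes_case_cls:
  assumes "a \<in> Ob A" "x \<in> Ob X" "b \<in> Ob A" "y \<in> Ob X"
    and "m \<in> Ob X" "s \<in> Hom A a (b \<otimes>\<^sub>A \<F> m)" "t \<in> Hom X (m \<otimes>\<^sub>X x) y"
    and "\<And>m n u s t. \<lbrakk>m \<in> Ob X; n \<in> Ob X; u \<in> Hom X m n; s \<in> Hom A a (b \<otimes>\<^sub>A \<F> m); t \<in> Hom X (n \<otimes>\<^sub>X x) y\<rbrakk>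
      \<Longrightarrow> \<phi> m (s, Cmp X (m \<otimes>\<^sub>X x) (n \<otimes>\<^sub>X x) y t (ten_ar X m n x x u (Idn X x)))
       = \<phi> n (Cmp A a (b \<otimes>\<^sub>A \<F> m) (b \<otimes>\<^sub>A \<F> n)
                (ten_ar A b b (\<F> m) (\<F> n) (Idn A b) (Fm F m n u)) s, t)"
  shows "coend_case \<phi> (cls (a, x) (b, y) m (s, t)) = \<phi> m (s, t)"
  using assms by (intro coend_case_inj) (simp_all add: dinatural_rtimes_integrand Fo_rtimes_integrand)

lemma rtimes_map_cls:
  assumes "a \<in> Ob A" "x \<in> Ob X" "b \<in> Ob A" "y \<in> Ob X"
    and "m \<in> Ob X" "s \<in> Hom A a (b \<otimes>\<^sub>A \<F> m)" "t \<in> Hom X (m \<otimes>\<^sub>X x) y"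
    and "\<And>m n u s t. \<lbrakk>m \<in> Ob X; n \<in> Ob X; u \<in> Hom X m n; s \<in> Hom A a (b \<otimes>\<^sub>A \<F> m); t \<in> Hom X (n \<otimes>\<^sub>X x) y\<rbrakk>
      \<Longrightarrow> cls c d m (\<theta> m (s, Cmp X (m \<otimes>\<^sub>X x) (n \<otimes>\<^sub>X x) y t (ten_ar X m n x x u (Idn X x))))
       = cls c d n (\<theta> n (Cmp A a (b \<otimes>\<^sub>A \<F> m) (b \<otimes>\<^sub>A \<F> n)
                (ten_ar A b b (\<F> m) (\<F> n) (Idn A b) (Fm F m n u)) s, t))"
  shows "coend_map X (rtimes_integrand A X F (a, x) (b, y)) (rtimes_integrand A X F c d) \<theta>
      (cls (a, x) (b, y) m (s, t)) = cls c d m (\<theta> m (s, t))"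
  using assms by (intro coend_map_inj) (simp_all add: dinatural_rtimes_integrand Fo_rtimes_integrand)

section \<open>Composition of classes\<close>

definition rtimes_cmp where
  "rtimes_cmp = (\<lambda>(a, x) (b, y) (c, z) q p.
     coend_case (\<lambda>m (s, t). coend_case (\<lambda>n (s', t').
       cls (a, x) (c, z) (n \<otimes>\<^sub>X m) (comp_A a b c m n s' s, comp_X x y z m n t' t)) q) p)"

lemma rtimes_mult_eq:
  "rtimes_mult A X F \<psi>2 (c, e) = coend_case (\<lambda>d (p, q). rtimes_cmp c d e q p)"
  by (simp add: rtimes_mult_def rtimes_cmp_def comp_A_def comp_X_def split_beta' fun_eq_iff split: prod.split)

text \<open>Two eliminations are nested, hence two checks: in the second arrow for a fixed
  representative of the first, then in the first arrow. Each joins the shift lemmas of the two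
  components by \<open>rtimes_class_balanced\<close>.\<close>

lemma rtimes_cmp_cls:
  assumes ob: "a \<in> Ob A" "b \<in> Ob A" "c \<in> Ob A" "x \<in> Ob X" "y \<in> Ob X" "z \<in> Ob X"
    and m: "m \<in> Ob X" "s \<in> Hom A a (b \<otimes>\<^sub>A \<F> m)" "t \<in> Hom X (m \<otimes>\<^sub>X x) y"
    and n: "n \<in> Ob X" "s' \<in> Hom A b (c \<otimes>\<^sub>A \<F> n)" "t' \<in> Hom X (n \<otimes>\<^sub>X y) z"
  shows "rtimes_cmp (a, x) (b, y) (c, z) (cls (b, y) (c, z) n (s', t')) (cls (a, x) (b, y) m (s, t))
    = cls (a, x) (c, z) (n \<otimes>\<^sub>X m) (comp_A a b c m n s' s, comp_X x y z m n t' t)"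
proof -
  have inner: "coend_case (\<lambda>n (s', t').
       cls (a, x) (c, z) (n \<otimes>\<^sub>X m) (comp_A a b c m n s' s, comp_X x y z m n t' t)) (cls (b, y) (c, z) n (s', t'))
     = cls (a, x) (c, z) (n \<otimes>\<^sub>X m) (comp_A a b c m n s' s, comp_X x y z m n t' t)"
    if m: "m \<in> Ob X" "s \<in> Hom A a (b \<otimes>\<^sub>A \<F> m)" "t \<in> Hom X (m \<otimes>\<^sub>X x) y" for m s t
  proof (subst rtimes_case_cls, goal_cases)
    case (8 k l u s' t')
    then show ?case
      using ob m
      by (simp add: comp_A_shift_left comp_X_shift_left rtimes_class_balanced comp_A_in comp_X_in X.ten_ob_in
        X.ten_ar_in X.idn_in)
  qed (use ob n in simp_all)
  show ?thesis
    unfolding rtimes_cmp_def prod.case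
  proof (rule trans[OF rtimes_case_cls], goal_cases)
    case (8 k l u s t)
    have "Cmp X (k \<otimes>\<^sub>X x) (l \<otimes>\<^sub>X x) y t (ten_ar X k l x x u (Idn X x)) \<in> Hom X (k \<otimes>\<^sub>X x) y"
      "Cmp A a (b \<otimes>\<^sub>A \<F> k) (b \<otimes>\<^sub>A \<F> l) (ten_ar A b b (\<F> k) (\<F> l) (Idn A b) (Fm F k l u)) s
        \<in> Hom A a (b \<otimes>\<^sub>A \<F> l)"
      using 8 ob by (simp_all add: rules)
    with 8 show ?case
      using ob n
      by (simp add: inner comp_A_shift_right comp_X_shift_right rtimes_class_balanced comp_A_in comp_X_in X.ten_ob_in
        X.ten_ar_in X.idn_in)
  qed (use ob m in \<open>simp_all add: inner\<close>)
qed

lemma rtimes_unit_eq: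
  "rtimes_unit A X F \<psi>0 ((a, x), (b, y)) (f, g) = cls (a, x) (b, y) (Unt X)
     (Cmp A a b (b \<otimes>\<^sub>A \<F> (Unt X)) (ten_ar A b b (Unt A) (\<F> (Unt X)) (Idn A b) \<psi>0) f, g)"
  by (simp add: rtimes_unit_def)

lemma unit_A_in:
  "\<lbrakk>a \<in> Ob A; b \<in> Ob A; f \<in> Hom A a b\<rbrakk> \<Longrightarrow>
    Cmp A a b (b \<otimes>\<^sub>A \<F> (Unt X)) (ten_ar A b b (Unt A) (\<F> (Unt X)) (Idn A b) \<psi>0) f
      \<in> Hom A a (b \<otimes>\<^sub>A \<F> (Unt X))"
  by (simp add: rules psi0_in)

lemma rtimes_unit_in:
  assumes "a \<in> Ob A" "b \<in> Ob A" "x \<in> Ob X" "y \<in> Ob X" "f \<in> Hom A a b" "g \<in> Hom X x y"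
  shows "rtimes_unit A X F \<psi>0 ((a, x), (b, y)) (f, g) \<in> Fo (rtimes A X F) ((a, x), (b, y))"
  unfolding rtimes_unit_eq
  using assms by (intro rtimes_class_in unit_A_in) (simp_all add: rules)

text \<open>Strictness puts the product at \<open>Unt X \<otimes> m = m\<close>, so composing with
  the image of an arrow of \<open>A \<times> X\<close> changes a representative without changing its
  index.\<close>

lemma rtimes_cmp_unit_left:
  assumes "a \<in> Ob A" "b \<in> Ob A" "c \<in> Ob A" "x \<in> Ob X" "y \<in> Ob X" "z \<in> Ob X" "m \<in> Ob X"
    "s \<in> Hom A a (b \<otimes>\<^sub>A \<F> m)" "t \<in> Hom X (m \<otimes>\<^sub>X x) y" "h \<in> Hom A b c" "k \<in> Hom X y z"
  shows "rtimes_cmp (a, x) (b, y) (c, z) (rtimes_unit A X F \<psi>0 ((b, y), (c, z)) (h, k))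
      (cls (a, x) (b, y) m (s, t))
    = cls (a, x) (c, z) m (Cmp A a (b \<otimes>\<^sub>A \<F> m) (c \<otimes>\<^sub>A \<F> m) (ten_ar A b c (\<F> m) (\<F> m) h (Idn A (\<F> m))) s,
        Cmp X (m \<otimes>\<^sub>X x) y z k t)"
  using assms unfolding rtimes_unit_eq
  by (subst rtimes_cmp_cls)
    (simp_all add: comp_A_unit_left comp_X_unit_left unit_A_in X.unt_in X.ten_ob_unt_left)

lemma rtimes_cmp_unit_right:
  assumes "a \<in> Ob A" "b \<in> Ob A" "c \<in> Ob A" "x \<in> Ob X" "y \<in> Ob X" "z \<in> Ob X" "m \<in> Ob X"
    "s \<in> Hom A b (c \<otimes>\<^sub>A \<F> m)" "t \<in> Hom X (m \<otimes>\<^sub>X y) z" "f \<in> Hom A a b" "g \<in> Hom X x y"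
  shows "rtimes_cmp (a, x) (b, y) (c, z) (cls (b, y) (c, z) m (s, t))
      (rtimes_unit A X F \<psi>0 ((a, x), (b, y)) (f, g))
    = cls (a, x) (c, z) m (Cmp A a b (c \<otimes>\<^sub>A \<F> m) s f,
        Cmp X (m \<otimes>\<^sub>X x) (m \<otimes>\<^sub>X y) z t (ten_ar X m m x y (Idn X m) g))"
  using assms unfolding rtimes_unit_eq
  by (subst rtimes_cmp_cls)
    (simp_all add: comp_A_unit_right comp_X_unit_right unit_A_in X.unt_in X.ten_ob_unt_left X.ten_ob_unt_right)

text \<open>
  The Kleisli category, except that the composition is defined on pairs of classes directly rather
  than through the coend over \<open>A \<times> X\<close>: well-definedness of the multiplication on that coend is a
  consequence of the laws of this category.
\<close>

definition rtimes_category where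
  "rtimes_category = \<lparr>Ob = Ob A \<times> Ob X, Hom = (\<lambda>c d. Fo (rtimes A X F) (c, d)),
     Idn = (\<lambda>c. rtimes_unit A X F \<psi>0 (c, c) (Idn A (fst c), Idn X (snd c))), Cmp = rtimes_cmp\<rparr>"

text \<open>The laws hold already for representatives: both bracketings of a triple product sit at
  the same object because X is strict, and the unit laws keep the index \<open>m\<close>. The coend
  relation enters only through \<open>rtimes_cmp_cls\<close>.\<close>

lemma category_rtimes_category: "category rtimes_category"
proof (unfold_locales, goal_cases)
  case (1 a)
  then show ?case
    by (cases a) (auto simp: rtimes_category_def intro!: rtimes_unit_in A.idn_in X.idn_in)
next
  case (2 a b c f g)
  then show ?case
    by (auto simp: rtimes_category_def rtimes_cmp_cls elim!: rtimes_classE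
      intro!: rtimes_class_in comp_A_in comp_X_in X.ten_ob_in)
next
  case (3 a b f)
  then show ?case
    by (auto simp: rtimes_category_def rtimes_cmp_unit_right X.ten_ar_idn rules X.idn_rules A.idn_rules elim!: rtimes_classE)
next
  case (4 a b f)
  then show ?case
    by (auto simp: rtimes_category_def rtimes_cmp_unit_left A.ten_ar_idn rules X.idn_rules A.idn_rules elim!: rtimes_classE)
next
  case (5 a b c d f g h)
  then show ?case
    by (clarsimp simp: rtimes_category_def rtimes_cmp_cls X.ten_ob_in comp_A_in comp_X_in elim!: rtimes_classE)
      (simp add: comp_A_assoc comp_X_assoc X.ten_ob_assoc)
qed

section \<open>The functor from \<open>A \<times> X\<close> to the category of classes\<close>

lemma Fm_rtimes_cls:
  assumes "a \<in> Ob A" "a' \<in> Ob A" "b \<in> Ob A" "b' \<in> Ob A" "x \<in> Ob X" "x' \<in> Ob X" "y \<in> Ob X" "y' \<in> Ob X"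
    "f \<in> Hom A a' a" "g \<in> Hom X x' x" "h \<in> Hom A b b'" "k \<in> Hom X y y'"
    "m \<in> Ob X" "s \<in> Hom A a (b \<otimes>\<^sub>A \<F> m)" "t \<in> Hom X (m \<otimes>\<^sub>X x) y"
  shows "Fm (rtimes A X F) ((a, x), (b, y)) ((a', x'), (b', y')) ((f, g), (h, k)) (cls (a, x) (b, y) m (s, t))
    = cls (a', x') (b', y') m
        (Cmp A a' (b \<otimes>\<^sub>A \<F> m) (b' \<otimes>\<^sub>A \<F> m) (ten_ar A b b' (\<F> m) (\<F> m) h (Idn A (\<F> m)))
           (Cmp A a' a (b \<otimes>\<^sub>A \<F> m) s f),
         Cmp X (m \<otimes>\<^sub>X x') y y' k (Cmp X (m \<otimes>\<^sub>X x') (m \<otimes>\<^sub>X x) y t (ten_ar X m m x' x (Idn X m) g)))"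
  unfolding rtimes_def using assms
proof (simp, subst rtimes_map_cls, goal_cases)
  case (8 m n u s t)
  \<comment> \<open>\<open>h\<close> acts on the tensor factor beside \<open>F m\<close> and
    \<open>g\<close> on the one beside \<open>m\<close>, so both commute with the coend arrow
    \<open>u\<close>; \<open>f\<close> and \<open>k\<close> are merely composed at the outer
    ends.\<close>
  have A: "Cmp A (b \<otimes>\<^sub>A \<F> m) (b \<otimes>\<^sub>A \<F> n) (b' \<otimes>\<^sub>A \<F> n) (ten_ar A b b' (\<F> n) (\<F> n) h (Idn A (\<F> n)))
      (ten_ar A b b (\<F> m) (\<F> n) (Idn A b) (Fm F m n u))
    = Cmp A (b \<otimes>\<^sub>A \<F> m) (b' \<otimes>\<^sub>A \<F> m) (b' \<otimes>\<^sub>A \<F> n) (ten_ar A b' b' (\<F> m) (\<F> n) (Idn A b') (Fm F m n u))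
       (ten_ar A b b' (\<F> m) (\<F> m) h (Idn A (\<F> m)))"
    using 8 by (intro A.exchange) (simp_all add: rules)
  have X: "Cmp X (m \<otimes>\<^sub>X x') (m \<otimes>\<^sub>X x) (n \<otimes>\<^sub>X x) (ten_ar X m n x x u (Idn X x)) (ten_ar X m m x' x (Idn X m) g)
    = Cmp X (m \<otimes>\<^sub>X x') (n \<otimes>\<^sub>X x') (n \<otimes>\<^sub>X x) (ten_ar X n n x' x (Idn X n) g) (ten_ar X m n x' x' u (Idn X x'))"
    using 8 by (intro X.exchange) simp_all
  show ?case
    using 8 rtimes_class_balanced[of a' x' b' y' m n u
        "Cmp A a' (b \<otimes>\<^sub>A \<F> m) (b' \<otimes>\<^sub>A \<F> m) (ten_ar A b b' (\<F> m) (\<F> m) h (Idn A (\<F> m)))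
           (Cmp A a' a (b \<otimes>\<^sub>A \<F> m) s f)"
        "Cmp X (n \<otimes>\<^sub>X x') y y' k (Cmp X (n \<otimes>\<^sub>X x') (n \<otimes>\<^sub>X x) y t (ten_ar X n n x' x (Idn X n) g))"]
    by (simp add: rules A.cmp_assoc[symmetric] X.cmp_assoc[symmetric] A.cmp_square[OF A] X)
qed simp_all

lemma identity_on_objects_rtimes:
  "identity_on_objects (prod_cat A X) rtimes_category (rtimes A X F) (rtimes_unit A X F \<psi>0)
    (rtimes_mult A X F \<psi>2)"
proof (intro identity_on_objects.intro identity_on_objects_axioms.intro category_prod
    A.category_axioms X.category_axioms category_rtimes_category, goal_cases)
  case (3 c d f)
  then show ?case
    by (cases c, cases d, cases f) (simp add: prod_cat_def rtimes_category_def rtimes_unit_in)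
next
  case (5 c d e f g)
  obtain a x b y a' x' f1 f2 g1 g2 where
    "c = (a, x)" "d = (b, y)" "e = (a', x')" "f = (f1, f2)" "g = (g1, g2)"
    by (cases c, cases d, cases e, cases f, cases g)
  moreover have "cls (a, x) (a', x') (Unt X) (Cmp A a a' (a' \<otimes>\<^sub>A \<F> (Unt X))
        (ten_ar A a' a' (Unt A) (\<F> (Unt X)) (Idn A a') \<psi>0) (Cmp A a b a' g1 f1), Cmp X x y x' g2 f2)
    = rtimes_cmp (a, x) (b, y) (a', x') (rtimes_unit A X F \<psi>0 ((b, y), (a', x')) (g1, g2))
       (cls (a, x) (b, y) (Unt X) (Cmp A a b (b \<otimes>\<^sub>A \<F> (Unt X))
         (ten_ar A b b (Unt A) (\<F> (Unt X)) (Idn A b) \<psi>0) f1, f2))"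
    if *: "a \<in> Ob A" "b \<in> Ob A" "a' \<in> Ob A" "x \<in> Ob X" "y \<in> Ob X" "x' \<in> Ob X"
      "f1 \<in> Hom A a b" "f2 \<in> Hom X x y" "g1 \<in> Hom A b a'" "g2 \<in> Hom X y x'"
  proof -
    \<comment> \<open>The unit preserves composites because \<open>g1\<close> and
      \<open>\<psi>0\<close> act on different factors once \<open>b\<close> is read as
      \<open>b \<otimes> Unt A\<close>.\<close>
    have "Cmp A b (b \<otimes>\<^sub>A \<F> (Unt X)) (a' \<otimes>\<^sub>A \<F> (Unt X))
        (ten_ar A b a' (\<F> (Unt X)) (\<F> (Unt X)) g1 (Idn A (\<F> (Unt X))))
        (ten_ar A b b (Unt A) (\<F> (Unt X)) (Idn A b) \<psi>0)
      = Cmp A b a' (a' \<otimes>\<^sub>A \<F> (Unt X)) (ten_ar A a' a' (Unt A) (\<F> (Unt X)) (Idn A a') \<psi>0) g1"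
      using * A.exchange[of _ b "Unt A" _ "\<F> (Unt X)" _ a' g1 \<psi>0]
      by (simp add: rules psi0_in A.ten_ar_unt_right)
    note square = A.cmp_square[OF this]
    show ?thesis
      using * by (subst rtimes_cmp_unit_left) (simp_all add: rules psi0_in square)
  qed
  ultimately show ?case
    using 5 by (simp add: prod_cat_def rtimes_category_def rtimes_unit_eq)
next
  case (6 c d c' d' f g)
  then show ?case
    by (cases c, cases d, cases c', cases d', cases f, cases g)
      (simp add: rtimes_category_def rtimes_def coend_map_def)
next
  case (7 c d c' d' f g p)
  obtain a x b y a' x' b' y' f1 f2 g1 g2 where eqs:
    "c = (a, x)" "d = (b, y)" "c' = (a', x')" "d' = (b', y')" "f = (f1, f2)" "g = (g1, g2)"
    by (cases c, cases d, cases c', cases d', cases f, cases g)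
  from 7 have "p \<in> Fo (rtimes A X F) ((a, x), (b, y))"
    by (simp add: rtimes_category_def eqs)
  then show ?case
    by (rule rtimes_classE) (use 7 in \<open>simp add: prod_cat_def rtimes_category_def eqs Fm_rtimes_cls
      rtimes_cmp_unit_left rtimes_cmp_unit_right rules\<close>)
qed (simp_all add: rtimes_category_def prod_cat_def rtimes_mult_eq)

abbreviation kl where "kl \<equiv> rtimes_kleisli A X F \<psi>0 \<psi>2"

lemma kl_simps:
  "Ob kl = Ob A \<times> Ob X" "Hom kl c d = Fo (rtimes A X F) (c, d)"
  "Idn kl c = rtimes_unit A X F \<psi>0 (c, c) (Idn A (fst c), Idn X (snd c))"
  by (simp_all add: rtimes_kleisli_def kleisli_def prod_cat_def)

lemma category_kl: "category kl"
  unfolding rtimes_kleisli_def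
  by (rule identity_on_objects.category_kleisli[OF identity_on_objects_rtimes])

lemma Cmp_kl:
  assumes "a \<in> Ob A" "b \<in> Ob A" "c \<in> Ob A" "x \<in> Ob X" "y \<in> Ob X" "z \<in> Ob X"
    and "m \<in> Ob X" "s \<in> Hom A a (b \<otimes>\<^sub>A \<F> m)" "t \<in> Hom X (m \<otimes>\<^sub>X x) y"
    and "n \<in> Ob X" "s' \<in> Hom A b (c \<otimes>\<^sub>A \<F> n)" "t' \<in> Hom X (n \<otimes>\<^sub>X y) z"
  shows "Cmp kl (a, x) (b, y) (c, z) (cls (b, y) (c, z) n (s', t')) (cls (a, x) (b, y) m (s, t))
    = cls (a, x) (c, z) (n \<otimes>\<^sub>X m) (comp_A a b c m n s' s, comp_X x y z m n t' t)"
  unfolding rtimes_kleisli_def using assms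
  by (subst identity_on_objects.Cmp_kleisli[OF identity_on_objects_rtimes])
    (simp_all add: rtimes_category_def prod_cat_def rtimes_class_in rtimes_cmp_cls)

section \<open>The bimodular structure on the Kleisli category\<close>

text \<open>Tensoring on the left leaves the right-hand factor \<open>F m\<close> alone, so the
  coend arrow \<open>u\<close> still acts at the right end of
  \<open>b' \<otimes> b \<otimes> F m\<close>.\<close>

lemma left_act_cls:
  assumes "a \<in> Ob A" "b \<in> Ob A" "a' \<in> Ob A" "b' \<in> Ob A" "x \<in> Ob X" "y \<in> Ob X"
    "f \<in> Hom A a' b'" "m \<in> Ob X" "s \<in> Hom A a (b \<otimes>\<^sub>A \<F> m)" "t \<in> Hom X (m \<otimes>\<^sub>X x) y"
  shows "Fm (rtimes_left_act A X F) (a', (a, x)) (b', (b, y)) (f, cls (a, x) (b, y) m (s, t))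
    = cls (a' \<otimes>\<^sub>A a, x) (b' \<otimes>\<^sub>A b, y) m (ten_ar A a' b' a (b \<otimes>\<^sub>A \<F> m) f s, t)"
  unfolding rtimes_left_act_def using assms
proof (simp, subst rtimes_map_cls, goal_cases)
  case (8 m n u s t)
  then show ?case
    using rtimes_class_balanced[of "a' \<otimes>\<^sub>A a" x "b' \<otimes>\<^sub>A b" y m n u "ten_ar A a' b' a (b \<otimes>\<^sub>A \<F> m) f s" t]
    by (simp add: rules A.ten_ar_idn_assoc A.ten_ar_cmp A.idn_rules)
qed simp_all

lemma right_act_cls:
  assumes "a \<in> Ob A" "b \<in> Ob A" "x \<in> Ob X" "y \<in> Ob X" "x' \<in> Ob X" "y' \<in> Ob X"
    "g \<in> Hom X x' y'" "m \<in> Ob X" "s \<in> Hom A a (b \<otimes>\<^sub>A \<F> m)" "t \<in> Hom X (m \<otimes>\<^sub>X x) y"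
  shows "Fm (rtimes_right_act A X F) ((a, x), x') ((b, y), y') (cls (a, x) (b, y) m (s, t), g)
    = cls (a, x \<otimes>\<^sub>X x') (b, y \<otimes>\<^sub>X y') m (s, ten_ar X (m \<otimes>\<^sub>X x) y x' y' t g)"
  unfolding rtimes_right_act_def using assms
proof (simp, subst rtimes_map_cls, goal_cases)
  case (8 m n u s t)
  \<comment> \<open>\<open>g\<close> is written as \<open>g \<circ> id\<close>, so that the tensor
    of composites splits \<open>u\<close> off from \<open>t \<otimes> g\<close>.\<close>
  have "ten_ar X (m \<otimes>\<^sub>X x) y x' y' (Cmp X (m \<otimes>\<^sub>X x) (n \<otimes>\<^sub>X x) y t (ten_ar X m n x x u (Idn X x))) g
    = Cmp X (m \<otimes>\<^sub>X x \<otimes>\<^sub>X x') (n \<otimes>\<^sub>X x \<otimes>\<^sub>X x') (y \<otimes>\<^sub>X y') (ten_ar X (n \<otimes>\<^sub>X x) y x' y' t g)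
        (ten_ar X m n (x \<otimes>\<^sub>X x') (x \<otimes>\<^sub>X x') u (Idn X (x \<otimes>\<^sub>X x')))"
    using 8 X.ten_ar_cmp[of _ "m \<otimes>\<^sub>X x" x' _ "n \<otimes>\<^sub>X x" x' _ y y' "ten_ar X m n x x u (Idn X x)" t "Idn X x'" g]
    by (simp add: rules X.ten_ar_assoc' X.ten_ar_idn X.idn_rules)
  then show ?case
    using 8 rtimes_class_balanced[of a "x \<otimes>\<^sub>X x'" b "y \<otimes>\<^sub>X y'" m n u s "ten_ar X (n \<otimes>\<^sub>X x) y x' y' t g"]
    by (simp add: rules)
qed simp_all

lemma act_ob_simps:
  "Fo (rtimes_left_act A X F) (a', (a, x)) = (a' \<otimes>\<^sub>A a, x)"
  "Fo (rtimes_right_act A X F) ((a, x), x') = (a, x \<otimes>\<^sub>X x')"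
  by (simp_all add: rtimes_left_act_def rtimes_right_act_def)

lemma left_action_kl: "left_action A kl (rtimes_left_act A X F)"
proof (intro left_action.intro left_action_axioms.intro is_functor.intro is_functor_axioms.intro
    category_prod A.category_axioms A.strict_monoidal_axioms category_kl, goal_cases)
  case (1 a)
  then show ?case
    by (auto simp: kl_simps prod_cat_def act_ob_simps A.ten_ob_in)
next
  case (2 a b f)
  then show ?case
    by (auto simp: kl_simps prod_cat_def act_ob_simps left_act_cls rules elim!: rtimes_classE intro!: rtimes_class_in)
next
  case (3 a)
  then show ?case
    by (clarsimp simp: kl_simps prod_cat_def act_ob_simps rtimes_unit_eq left_act_cls unit_A_in rules)
      (simp add: rules psi0_in A.idn_rules A.ten_ar_idn_assoc)
next
  case (4 p q r f g)
  \<comment> \<open>Functoriality of the tensor product: the acting arrows compose on the left,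
    while on the right \<open>comp_A\<close> applies \<open>\<psi>2\<close> beside the identity of
    \<open>c1\<close>.\<close>
  have "ten_ar A a1 c1 a (c \<otimes>\<^sub>A \<F> (n \<otimes>\<^sub>X m)) (Cmp A a1 b1 c1 g f) (comp_A a b c m n s' s)
    = comp_A (a1 \<otimes>\<^sub>A a) (b1 \<otimes>\<^sub>A b) (c1 \<otimes>\<^sub>A c) m n
        (ten_ar A b1 c1 b (c \<otimes>\<^sub>A \<F> n) g s') (ten_ar A a1 b1 a (b \<otimes>\<^sub>A \<F> m) f s)"
    if "a \<in> Ob A" "b \<in> Ob A" "c \<in> Ob A" "a1 \<in> Ob A" "b1 \<in> Ob A" "c1 \<in> Ob A" "m \<in> Ob X" "n \<in> Ob X"
      "f \<in> Hom A a1 b1" "g \<in> Hom A b1 c1" "s \<in> Hom A a (b \<otimes>\<^sub>A \<F> m)" "s' \<in> Hom A b (c \<otimes>\<^sub>A \<F> n)"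
    for a b c a1 b1 c1 m n s s' f g
    using that
    by (simp add: comp_A_def rules psi2_in A.ten_ar_assoc' A.ten_ar_idn_assoc A.ten_ar_cmp A.idn_rules)
  then show ?case
    using 4
    by (clarsimp simp: kl_simps prod_cat_def act_ob_simps left_act_cls Cmp_kl comp_A_in comp_X_in
        X.ten_ob_in A.cmp_in elim!: rtimes_classE)
      (simp add: Cmp_kl rules)
next
  case (6 x y h)
  then show ?case
    by (clarsimp simp: kl_simps act_ob_simps left_act_cls rules A.ten_ar_unt_left elim!: rtimes_classE)
next
  case (8 a a' b b' x y f g h)
  then show ?case
    by (clarsimp simp: kl_simps act_ob_simps left_act_cls rules A.ten_ar_assoc' elim!: rtimes_classE)
qed (auto simp: kl_simps act_ob_simps rules)

lemma right_action_kl: "right_action kl X (rtimes_right_act A X F)"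
proof (intro right_action.intro right_action_axioms.intro is_functor.intro is_functor_axioms.intro
    category_prod X.category_axioms X.strict_monoidal_axioms category_kl, goal_cases)
  case (1 a)
  then show ?case
    by (auto simp: kl_simps prod_cat_def act_ob_simps X.ten_ob_in)
next
  case (2 a b f)
  then show ?case
    by (auto simp: kl_simps prod_cat_def act_ob_simps right_act_cls rules elim!: rtimes_classE intro!: rtimes_class_in)
next
  case (3 a)
  then show ?case
    by (clarsimp simp: kl_simps prod_cat_def act_ob_simps rtimes_unit_eq right_act_cls unit_A_in rules)
      (simp add: rules X.ten_ar_idn)
next
  case (4 p q r f g)
  have "ten_ar X (n \<otimes>\<^sub>X m \<otimes>\<^sub>X x) z x1 z1 (comp_X x y z m n t' t) (Cmp X x1 y1 z1 g f)
    = comp_X (x \<otimes>\<^sub>X x1) (y \<otimes>\<^sub>X y1) (z \<otimes>\<^sub>X z1) m n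
        (ten_ar X (n \<otimes>\<^sub>X y) z y1 z1 t' g) (ten_ar X (m \<otimes>\<^sub>X x) y x1 y1 t f)"
    if "x \<in> Ob X" "y \<in> Ob X" "z \<in> Ob X" "x1 \<in> Ob X" "y1 \<in> Ob X" "z1 \<in> Ob X" "m \<in> Ob X" "n \<in> Ob X"
      "f \<in> Hom X x1 y1" "g \<in> Hom X y1 z1" "t \<in> Hom X (m \<otimes>\<^sub>X x) y" "t' \<in> Hom X (n \<otimes>\<^sub>X y) z"
    for x y z x1 y1 z1 m n t t' f g
    using that
    X.ten_ar_cmp[of _ "n \<otimes>\<^sub>X m \<otimes>\<^sub>X x" x1 _ "n \<otimes>\<^sub>X y" y1 _ z z1 "ten_ar X n n (m \<otimes>\<^sub>X x) y (Idn X n) t" t' f g]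
    by (simp add: comp_X_def rules X.ten_ar_assoc')
  then show ?case
    using 4
    by (clarsimp simp: kl_simps prod_cat_def act_ob_simps right_act_cls Cmp_kl comp_A_in comp_X_in
        X.ten_ob_in X.cmp_in elim!: rtimes_classE)
      (simp add: Cmp_kl rules)
next
  case (6 x y h)
  then show ?case
    by (clarsimp simp: kl_simps act_ob_simps right_act_cls rules X.ten_ar_unt_right elim!: rtimes_classE)
next
  case (8 x y a a' b b' h f g)
  then show ?case
    by (clarsimp simp: kl_simps act_ob_simps right_act_cls rules X.ten_ar_assoc' elim!: rtimes_classE)
qed (auto simp: kl_simps act_ob_simps rules)

lemma bimodular_kl: "bimodular A X kl (rtimes_left_act A X F) (rtimes_right_act A X F)"
proof (intro bimodular.intro bimodular_axioms.intro left_action_kl right_action_kl, goal_cases)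
  case (2 a a' x x' n n' f h g)
  then show ?case
    by (clarsimp simp: kl_simps act_ob_simps left_act_cls right_act_cls rules elim!: rtimes_classE)
qed (auto simp: kl_simps act_ob_simps)

end

section \<open>Reversing the tensor product\<close>

text \<open>A record update, so that reversing twice gives back \<open>M\<close> itself and a double
  reverse can be removed by rewriting.\<close>

definition rev_moncat :: "('o, 'm, 'z) moncat_scheme \<Rightarrow> ('o, 'm, 'z) moncat_scheme" where
  "rev_moncat M = M\<lparr>Tensor := \<lparr>Fo = (\<lambda>(a, b). ten_ob M b a),
     Fm = (\<lambda>(a, b) (a', b') (f, g). ten_ar M b b' a a' g f)\<rparr>\<rparr>"

lemma rev_moncat_simps [simp]:
  "Ob (rev_moncat M) = Ob M" "Hom (rev_moncat M) = Hom M" "Idn (rev_moncat M) = Idn M"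
  "Cmp (rev_moncat M) = Cmp M" "Unt (rev_moncat M) = Unt M"
  "ten_ob (rev_moncat M) a b = ten_ob M b a"
  "ten_ar (rev_moncat M) a a' b b' f g = ten_ar M b b' a a' g f"
  by (simp_all add: rev_moncat_def)

lemma rev_moncat_rev_moncat: "rev_moncat (rev_moncat M) = M"
  by (cases M, cases "Tensor M") (auto simp: rev_moncat_def fun_eq_iff)

lemma category_rev_moncat: "category (rev_moncat M) \<longleftrightarrow> category M"
  by (simp add: category_def)

lemma prod_cat_rev_moncat: "prod_cat (rev_moncat M) (rev_moncat N) = prod_cat M N"
  by (simp add: prod_cat_def)

lemma strict_monoidal_rev_moncat:
  assumes "strict_monoidal M"
  shows "strict_monoidal (rev_moncat M)"
proof -
  interpret M: strict_monoidal M by fact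
  show ?thesis
  proof (intro strict_monoidal.intro strict_monoidal_axioms.intro is_functor.intro is_functor_axioms.intro
      category_prod, goal_cases)
    case (8 a b c f g)
    then show ?case
      by (auto simp: prod_cat_def M.ten_ar_cmp)
  qed (auto simp: category_rev_moncat prod_cat_def M.category_axioms M.hom_rules M.ob_rules M.ten_ar_idn
    M.ten_ar_assoc M.ten_ar_unt_left M.ten_ar_unt_right)
qed

lemma is_functor_comp:
  assumes "is_functor C D F" and "is_functor D E G"
  shows "is_functor C E (func_comp G F)"
proof -
  interpret F: is_functor C D F by fact
  interpret G: is_functor D E G by fact
  show ?thesis
    by unfold_locales (simp_all add: func_comp_def F.Fo_in G.Fo_in F.Fm_in G.Fm_in F.Fm_idn G.Fm_idn F.Fm_cmp G.Fm_cmp)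
qed

lemma is_functor_prod:
  assumes "is_functor C D F" and "is_functor C' D' G"
  shows "is_functor (prod_cat C C') (prod_cat D D') (func_prod F G)"
proof -
  interpret F: is_functor C D F by fact
  interpret G: is_functor C' D' G by fact
  show ?thesis
    by (intro is_functor.intro is_functor_axioms.intro category_prod F.dom.category_axioms F.cod.category_axioms
        G.dom.category_axioms G.cod.category_axioms)
      (auto simp: prod_cat_def func_prod_def F.Fo_in G.Fo_in F.Fm_in G.Fm_in F.Fm_idn G.Fm_idn F.Fm_cmp G.Fm_cmp)
qed

text \<open>With the arguments of \<open>\<psi>2\<close> exchanged, its associativity law turns into
  the same law read from right to left, and the two unit laws change places.\<close>

lemma lax_monoidal_functor_rev_moncat:
  assumes "lax_monoidal_functor X A F \<psi>0 \<psi>2"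
  shows "lax_monoidal_functor (rev_moncat X) (rev_moncat A) F \<psi>0 (\<lambda>(m, n). \<psi>2 (n, m))"
proof -
  interpret lax_monoidal_functor X A F \<psi>0 \<psi>2 by fact
  interpret X': strict_monoidal "rev_moncat X"
    by (intro strict_monoidal_rev_moncat X.strict_monoidal_axioms)
  interpret A': strict_monoidal "rev_moncat A"
    by (intro strict_monoidal_rev_moncat A.strict_monoidal_axioms)
  show ?thesis
  proof (intro lax_monoidal_functor.intro lax_monoidal_functor_axioms.intro nat_trans.intro nat_trans_axioms.intro
      strict_monoidal_rev_moncat X.strict_monoidal_axioms A.strict_monoidal_axioms, goal_cases)
    show F: "is_functor (rev_moncat X) (rev_moncat A) F"
      using is_functor_axioms by (simp add: is_functor_def is_functor_axioms_def category_rev_moncat)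
    show "is_functor (prod_cat (rev_moncat X) (rev_moncat X)) (rev_moncat A)
       (func_comp (Tensor (rev_moncat A)) (func_prod F F))"
      by (rule is_functor_comp[OF is_functor_prod[OF F F] A'.tensor.is_functor_axioms])
    show "is_functor (prod_cat (rev_moncat X) (rev_moncat X)) (rev_moncat A)
       (func_comp F (Tensor (rev_moncat X)))"
      by (rule is_functor_comp[OF X'.tensor.is_functor_axioms F])
  qed (use psi2_assoc[symmetric] psi_unit_left psi_unit_right in
    \<open>auto simp: prod_cat_def func_comp_def func_prod_def rules psi2_in psi0_in psi2_natural\<close>)
qed

text \<open>Only the objects are swapped. Arrows stay as they are because the elements of both
  profunctors list the index, the component in A and the component in X in this order.\<close>

definition swap_cat :: "('a \<times> 'b, 'm, 'z) cat_scheme \<Rightarrow> ('b \<times> 'a, 'm) cat" where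
  "swap_cat K = \<lparr>Ob = {c. prod.swap c \<in> Ob K}, Hom = (\<lambda>c d. Hom K (prod.swap c) (prod.swap d)),
     Idn = (\<lambda>c. Idn K (prod.swap c)),
     Cmp = (\<lambda>c d e. Cmp K (prod.swap c) (prod.swap d) (prod.swap e))\<rparr>"

lemma category_swap_cat: "category K \<Longrightarrow> category (swap_cat K)"
  by (auto simp: category_def swap_cat_def)

lemma identity_on_objects_swap:
  assumes "identity_on_objects (prod_cat C D) K P \<eta> \<mu>" and "category C" and "category D"
    and "\<And>c d. Fo P' (c, d) = Fo P (prod.swap c, prod.swap d)"
    and "\<And>c d c' d' f g. Fm P' (c, d) (c', d') (f, g)
      = Fm P (prod.swap c, prod.swap d) (prod.swap c', prod.swap d') (prod.swap f, prod.swap g)"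
    and "\<And>c d f. \<eta>' (c, d) f = \<eta> (prod.swap c, prod.swap d) (prod.swap f)"
    and "\<And>c e. \<mu>' (c, e) = coend_case (\<lambda>d (p, q). Cmp K (prod.swap c) (prod.swap d) (prod.swap e) q p)"
  shows "identity_on_objects (prod_cat D C) (swap_cat K) P' \<eta>' \<mu>'"
proof -
  interpret K: identity_on_objects "prod_cat C D" K P \<eta> \<mu> by fact
  have Ob: "prod.swap c \<in> Ob (prod_cat C D) \<longleftrightarrow> c \<in> Ob (prod_cat D C)" for c
    by (cases c) (auto simp: prod_cat_def)
  have Hom: "prod.swap f \<in> Hom (prod_cat C D) (prod.swap c) (prod.swap d) \<longleftrightarrow> f \<in> Hom (prod_cat D C) c d" for f c d
    by (cases f) (auto simp: prod_cat_def)
  have Idn: "prod.swap (Idn (prod_cat D C) c) = Idn (prod_cat C D) (prod.swap c)" for c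
    by (auto simp: prod_cat_def)
  have Cmp: "prod.swap (Cmp (prod_cat D C) c d e g f)
    = Cmp (prod_cat C D) (prod.swap c) (prod.swap d) (prod.swap e) (prod.swap g) (prod.swap f)" for c d e f g
    by (auto simp: prod_cat_def)
  show ?thesis
    using assms(4-)
    by (intro identity_on_objects.intro identity_on_objects_axioms.intro category_prod category_swap_cat
        assms(2,3) K.K.category_axioms)
      (simp_all add: swap_cat_def K.Ob_eq K.Fo_eq K.unit_in K.unit_idn K.unit_cmp K.Fm_ext K.Fm_eq
        Ob Hom Idn Cmp set_eq_iff)
qed

text \<open>Reversing a tensor product exchanges left and right actions. Composites of
  \<open>K'\<close> need to agree with those of \<open>K\<close> on arrows only: the Kleisli
  compositions concerned eliminate coends over products in opposite order and are compared only
  where they evaluate.\<close>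

lemma bimodular_swap:
  assumes bim: "bimodular M N K L R" and K': "category K'"
    and ob: "\<And>c. c \<in> Ob K' \<longleftrightarrow> prod.swap c \<in> Ob K"
    and hom: "\<And>c d. Hom K' c d = Hom K (prod.swap c) (prod.swap d)"
    and idn: "\<And>c. c \<in> Ob K' \<Longrightarrow> Idn K' c = Idn K (prod.swap c)"
    and cmp: "\<And>c d e p q. \<lbrakk>c \<in> Ob K'; d \<in> Ob K'; e \<in> Ob K'; p \<in> Hom K' c d; q \<in> Hom K' d e\<rbrakk>
      \<Longrightarrow> Cmp K' c d e q p = Cmp K (prod.swap c) (prod.swap d) (prod.swap e) q p"
    and L': "\<And>n c. Fo L' (n, c) = prod.swap (Fo R (prod.swap c, n))"
      "\<And>n n' c c' g p. Fm L' (n, c) (n', c') (g, p) = Fm R (prod.swap c, n) (prod.swap c', n') (p, g)"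
    and R': "\<And>m c. Fo R' (c, m) = prod.swap (Fo L (m, prod.swap c))"
      "\<And>m m' c c' f p. Fm R' (c, m) (c', m') (p, f) = Fm L (m, prod.swap c) (m', prod.swap c') (f, p)"
  shows "bimodular (rev_moncat N) (rev_moncat M) K' L' R'"
proof -
  interpret bimodular M N K L R by fact
  note monoidal = left.M.strict_monoidal_axioms right.N.strict_monoidal_axioms
  have Fo_L: "Fo L (m, c) \<in> Ob K" if "m \<in> Ob M" "c \<in> Ob K" for m c
    using left.Fo_in[of "(m, c)"] that by (simp add: prod_cat_def)
  have Fo_R: "Fo R (c, n) \<in> Ob K" if "n \<in> Ob N" "c \<in> Ob K" for n c
    using right.Fo_in[of "(c, n)"] that by (simp add: prod_cat_def)
  have Fm_L: "Fm L (m, c) (m', c') (f, p) \<in> Hom K (Fo L (m, c)) (Fo L (m', c'))"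
    if "m \<in> Ob M" "c \<in> Ob K" "m' \<in> Ob M" "c' \<in> Ob K" "f \<in> Hom M m m'" "p \<in> Hom K c c'" for m m' c c' f p
    using left.Fm_in[of "(m, c)" "(m', c')" "(f, p)"] that by (simp add: prod_cat_def)
  have Fm_R: "Fm R (c, m) (c', m') (p, f) \<in> Hom K (Fo R (c, m)) (Fo R (c', m'))"
    if "m \<in> Ob N" "c \<in> Ob K" "m' \<in> Ob N" "c' \<in> Ob K" "f \<in> Hom N m m'" "p \<in> Hom K c c'" for m m' c c' f p
    using right.Fm_in[of "(c, m)" "(c', m')" "(p, f)"] that by (simp add: prod_cat_def)
  have left: "left_action (rev_moncat N) K' L'"
  proof (intro left_action.intro left_action_axioms.intro is_functor.intro is_functor_axioms.intro
      category_prod strict_monoidal_rev_moncat monoidal K', goal_cases)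
    case (4 a)
    then show ?case
      using right.Fm_idn[of "(prod.swap (snd a), fst a)"]
      by (cases a) (simp add: L' prod_cat_def ob idn Fo_R)
  next
    case (5 a b c f g)
    then show ?case
      using right.Fm_cmp[of "(prod.swap (snd a), fst a)" "(prod.swap (snd b), fst b)" "(prod.swap (snd c), fst c)"
        "(snd f, fst f)" "(snd g, fst g)"]
      by (cases a, cases b, cases c, cases f, cases g) (simp add: L' prod_cat_def ob cmp hom Fo_R Fm_R)
  qed (auto simp: L' prod_cat_def ob hom Fo_R Fm_R category_rev_moncat right.N.category_axioms
    right.unit_ob right.unit_ar right.mult_ob right.mult_ar)
  have right: "right_action K' (rev_moncat M) R'"
  proof (intro right_action.intro right_action_axioms.intro is_functor.intro is_functor_axioms.intro
      category_prod strict_monoidal_rev_moncat monoidal K', goal_cases)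
    case (4 a)
    then show ?case
      using left.Fm_idn[of "(snd a, prod.swap (fst a))"]
      by (cases a) (simp add: R' prod_cat_def ob idn Fo_L)
  next
    case (5 a b c f g)
    then show ?case
      using left.Fm_cmp[of "(snd a, prod.swap (fst a))" "(snd b, prod.swap (fst b))" "(snd c, prod.swap (fst c))"
        "(snd f, fst f)" "(snd g, fst g)"]
      by (cases a, cases b, cases c, cases f, cases g) (simp add: R' prod_cat_def ob cmp hom Fo_L Fm_L)
  qed (auto simp: R' prod_cat_def ob hom Fo_L Fm_L category_rev_moncat left.M.category_axioms
    left.unit_ob left.unit_ar left.mult_ob left.mult_ar)
  show ?thesis
    using compat_ob compat_ar
    by (intro bimodular.intro bimodular_axioms.intro left right) (simp_all add: L' R' ob hom)
qed

section \<open>The promonad on \<open>X \<times> A\<close>\<close>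

lemma coend_eq_rev_moncat: "coend_eq (rev_moncat M) H = coend_eq M H"
  by (simp add: coend_eq_def coend_rel_def coend_carrier_def)

lemma coend_rev_moncat:
  "coend (rev_moncat M) H = coend M H" "coend_inj (rev_moncat M) H = coend_inj M H"
  "coend_map (rev_moncat M) H K = coend_map M H K"
  by (simp_all add: fun_eq_iff coend_def coend_inj_def coend_map_def coend_carrier_def coend_eq_rev_moncat)

text \<open>In the reversed structure \<open>b \<otimes> F m\<close> is
  \<open>F m \<otimes> b\<close> and \<open>m \<otimes> x\<close> is \<open>x \<otimes> m\<close>,
  so the integrands, and with them the coends, are equal and not merely isomorphic.\<close>

lemma ltimes_integrand_eq:
  "ltimes_integrand X A F c d
    = rtimes_integrand (rev_moncat A) (rev_moncat X) F (prod.swap c) (prod.swap d)"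
  by (cases c, cases d) (simp add: ltimes_integrand_def rtimes_integrand_def)

lemma identity_on_objects_ltimes:
  assumes "lax_monoidal_functor X A F \<psi>0 \<psi>2"
  shows "identity_on_objects (prod_cat X A)
    (swap_cat (lax_monoidal_functor.rtimes_category (rev_moncat X) (rev_moncat A) F \<psi>0 (\<lambda>(m, n). \<psi>2 (n, m))))
    (ltimes X A F) (ltimes_unit X A F \<psi>0) (ltimes_mult X A F \<psi>2)"
proof -
  interpret R: lax_monoidal_functor "rev_moncat X" "rev_moncat A" F \<psi>0 "\<lambda>(m, n). \<psi>2 (n, m)"
    by (rule lax_monoidal_functor_rev_moncat) fact
  show ?thesis
  proof (rule identity_on_objects_swap[OF R.identity_on_objects_rtimes[unfolded prod_cat_rev_moncat]], goal_cases)
    case (3 c d)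
    then show ?case
      by (simp add: ltimes_def rtimes_def coend_rev_moncat ltimes_integrand_eq)
  next
    case (4 c d c' d' f g)
    then show ?case
      by (cases c, cases d, cases c', cases d', cases f, cases g)
        (simp add: ltimes_def rtimes_def coend_rev_moncat ltimes_integrand_eq)
  next
    case (5 c d f)
    then show ?case
      by (cases c, cases d, cases f)
        (simp add: ltimes_unit_def rtimes_unit_def coend_rev_moncat ltimes_integrand_eq)
  next
    case (6 c e)
    then show ?case
      by (cases c, cases e, simp add: ltimes_mult_def R.rtimes_category_def R.rtimes_cmp_def R.comp_A_def
          R.comp_X_def coend_rev_moncat ltimes_integrand_eq, rule arg_cong[of _ _ coend_case])
        (simp add: fun_eq_iff)
  qed (use R.A.category_axioms R.X.category_axioms in \<open>simp_all add: category_rev_moncat\<close>)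
qed

lemma bimodular_ltimes:
  assumes "lax_monoidal_functor X A F \<psi>0 \<psi>2"
  shows "bimodular X A (ltimes_kleisli X A F \<psi>0 \<psi>2) (ltimes_left_act X A F) (ltimes_right_act X A F)"
proof -
  interpret R: lax_monoidal_functor "rev_moncat X" "rev_moncat A" F \<psi>0 "\<lambda>(m, n). \<psi>2 (n, m)"
    by (rule lax_monoidal_functor_rev_moncat) fact
  interpret I: identity_on_objects "prod_cat X A" "swap_cat R.rtimes_category"
    "ltimes X A F" "ltimes_unit X A F \<psi>0" "ltimes_mult X A F \<psi>2"
    by (rule identity_on_objects_ltimes) fact
  interpret J: identity_on_objects "prod_cat A X" R.rtimes_category
    "rtimes (rev_moncat A) (rev_moncat X) F" "rtimes_unit (rev_moncat A) (rev_moncat X) F \<psi>0"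
    "rtimes_mult (rev_moncat A) (rev_moncat X) F (\<lambda>(m, n). \<psi>2 (n, m))"
    by (rule R.identity_on_objects_rtimes[unfolded prod_cat_rev_moncat])
  have ob: "Ob (ltimes_kleisli X A F \<psi>0 \<psi>2) = Ob (prod_cat X A)" "Ob R.kl = Ob (prod_cat A X)"
    by (simp_all add: ltimes_kleisli_def rtimes_kleisli_def kleisli_def prod_cat_rev_moncat)
  have swap: "prod.swap c \<in> Ob (prod_cat A X) \<longleftrightarrow> c \<in> Ob (prod_cat X A)" for c
    by (cases c) (auto simp: prod_cat_def)
  have hom: "Hom (ltimes_kleisli X A F \<psi>0 \<psi>2) c d = Hom (swap_cat R.rtimes_category) c d"
    "Hom R.kl (prod.swap c) (prod.swap d) = Hom (swap_cat R.rtimes_category) c d" for c d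
    by (simp_all add: ltimes_kleisli_def rtimes_kleisli_def kleisli_def I.Fo_eq J.Fo_eq) (simp add: swap_cat_def)
  \<comment> \<open>The bimodular structure of the reversed situation is reversed once more; the
    double reverses are removed at the end.\<close>
  have "bimodular (rev_moncat (rev_moncat X)) (rev_moncat (rev_moncat A)) (ltimes_kleisli X A F \<psi>0 \<psi>2)
    (ltimes_left_act X A F) (ltimes_right_act X A F)"
  proof (rule bimodular_swap[OF R.bimodular_kl], goal_cases)
    case 1
    show ?case
      unfolding ltimes_kleisli_def by (rule I.category_kleisli)
  next
    case (4 c)
    then show ?case
      by (cases c) (simp add: ob R.kl_simps, simp add: ltimes_kleisli_def kleisli_def prod_cat_def ltimes_unit_def
        rtimes_unit_def coend_rev_moncat ltimes_integrand_eq)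
  next
    case (5 c d e p q)
    \<comment> \<open>The two Kleisli compositions come from coends over \<open>X \<times> A\<close>
      and \<open>A \<times> X\<close>; composition in \<open>R.rtimes_category\<close> is the common
      value through which they are compared.\<close>
    then have "Cmp (ltimes_kleisli X A F \<psi>0 \<psi>2) c d e q p = Cmp (swap_cat R.rtimes_category) c d e q p"
      unfolding ob hom unfolding ltimes_kleisli_def by (rule I.Cmp_kleisli)
    also have "\<dots> = Cmp R.rtimes_category (prod.swap c) (prod.swap d) (prod.swap e) q p"
      by (simp add: swap_cat_def)
    also have "\<dots> = Cmp R.kl (prod.swap c) (prod.swap d) (prod.swap e) q p"
      using 5 unfolding ob hom rtimes_kleisli_def prod_cat_rev_moncat
      by (intro J.Cmp_kleisli[symmetric]) (simp_all add: swap, simp_all add: swap_cat_def)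
    finally show ?case .
  next
    case (6 n c)
    show ?case
      by (cases c) (simp add: ltimes_left_act_def rtimes_right_act_def)
  next
    case (7 n n' c c' g p)
    show ?case
      by (cases c, cases c')
        (simp add: ltimes_left_act_def rtimes_right_act_def coend_rev_moncat ltimes_integrand_eq)
  next
    case (8 n c)
    show ?case
      by (cases c) (simp add: ltimes_right_act_def rtimes_left_act_def)
  next
    case (9 n n' c c' g p)
    show ?case
      by (cases c, cases c')
        (simp add: ltimes_right_act_def rtimes_left_act_def coend_rev_moncat ltimes_integrand_eq)
  qed (simp_all add: ob hom swap)
  then show ?thesis
    by (simp add: rev_moncat_rev_moncat)
qed

theorem proposition4p9:
  fixes X :: "('xo, 'xm) moncat" and A :: "('ao, 'am) moncat"
    and F :: "('xo, 'xm, 'ao, 'am) func"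
    and \<psi>0 :: 'am and \<psi>2 :: "'xo \<times> 'xo \<Rightarrow> 'am"
  assumes "strict_monoidal X" and "strict_monoidal A"
    and "lax_monoidal_functor X A F \<psi>0 \<psi>2"
  shows "endoprofunctor (prod_cat A X) (rtimes A X F)
    \<and> promonad (prod_cat A X) (rtimes A X F) (rtimes_unit A X F \<psi>0) (rtimes_mult A X F \<psi>2)
    \<and> category (rtimes_kleisli A X F \<psi>0 \<psi>2)
    \<and> bimodular A X (rtimes_kleisli A X F \<psi>0 \<psi>2) (rtimes_left_act A X F) (rtimes_right_act A X F)
    \<and> endoprofunctor (prod_cat X A) (ltimes X A F)
    \<and> promonad (prod_cat X A) (ltimes X A F) (ltimes_unit X A F \<psi>0) (ltimes_mult X A F \<psi>2)
    \<and> category (ltimes_kleisli X A F \<psi>0 \<psi>2)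
    \<and> bimodular X A (ltimes_kleisli X A F \<psi>0 \<psi>2) (ltimes_left_act X A F) (ltimes_right_act X A F)"
proof -
  note R = lax_monoidal_functor.identity_on_objects_rtimes[OF assms(3)]
    and L = identity_on_objects_ltimes[OF assms(3)]
  show ?thesis
    unfolding rtimes_kleisli_def ltimes_kleisli_def
    by (intro conjI identity_on_objects.endoprofunctor[OF R] identity_on_objects.promonad[OF R]
        identity_on_objects.category_kleisli[OF R] identity_on_objects.endoprofunctor[OF L]
        identity_on_objects.promonad[OF L] identity_on_objects.category_kleisli[OF L]
        lax_monoidal_functor.bimodular_kl[OF assms(3), unfolded rtimes_kleisli_def]
        bimodular_ltimes[OF assms(3), unfolded ltimes_kleisli_def])
qed

end
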